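(* There is an algorithm that, for any $\varepsilon>0$ and any election instance, outputs a full solution $(A,w)$ which is a $(2+\varepsilon)$-approximation for the maximin support problem and whose committee $A$ satisfies PJR, and which executes in time $O(\mathrm{bal}\cdot|C|\cdot\log(1/\varepsilon))$.
   Context: An election instance consists of a finite bipartite graph $G=(N\cup C,E)$ with no isolated vertices ($N$ = voters, $C$ = candidates), a vector $s\in\mathbb{R}^N$ of non-negative vote strengths, and an integer $k$ with $0<k<|C|$. Write $nc$ for $\{n,c\}$, $C_n=\{c: nc\in E\}$, $N_c=\{n: nc\in E\}$. A weight vector $w\in\mathbb{R}^E$ is feasible if $w\ge0$ and $\sum_{c\in C_n}w_{nc}\le s_n$ for all $n$. $\mathrm{supp}_w(c)=\sum_{n\in N_c}w_{nc}$, $\mathrm{supp}_w(A)=\min_{c\in A}\mathrm{supp}_w(c)$. A full solution is $(A,w)$ with $A\subseteq C$, $|A|=k$, $w$ feasible. The maximin support problem maximizes $\mathrm{supp}_w(A)$ over full solutions; OPT is the optimal value; a full solution is an $\alpha$-approximation if $\mathrm{supp}_w(A)\ge\mathrm{OPT}/\alpha$. A feasible $w$ is balanced for $A$ if it maximizes $\sum_{c\in A}\mathrm{supp}_w(c)$ over feasible vectors and, among those, minimizes $\sum_{c\in A}\mathrm{supp}_w(c)^2$; $\mathrm{bal}$ denotes the time complexity of computing a balanced weight vector for a given committee. Numerical operations take constant time. A committee $A$ with $|A|=k$ satisfies PJR if there is no $N'\subseteq N$ and integer $0<r\le k$ with (a) $\sum_{n\in N'}s_n\ge\frac rk\sum_{n\in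 N}s_n$, (b) $|\bigcap_{n\in N'}C_n|\ge r$, (c) $|A\cap\bigcup_{n\in N'}C_n|<r$.
   Formalization: PJR is claimed only when the total vote strength is positive (with all strengths zero no committee may satisfy PJR), and since log(1/ε) vanishes or is negative for ε near or above 1, the time bound uses log(1/min(ε,1/2)); vertices are labelled by natural numbers. *)

theory Defs
  imports Complex_Main
begin

section \<open>Elections and the maximin support problem\<close>

record ('v, 'c) election =
  voters :: "'v set"
  cands :: "'c set"
  edges :: "('v \<times> 'c) set"
  strength :: "'v \<Rightarrow> real"
  seats :: nat

definition election_instance :: "('v, 'c) election \<Rightarrow> bool" where
  "election_instance I \<longleftrightarrow>
     finite (voters I) \<and> finite (cands I) \<and>
     edges I \<subseteq> voters I \<times> cands I \<and>
     (\<forall>n\<in>voters I. \<exists>c. (n, c) \<in> edges I) \<and>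
     (\<forall>c\<in>cands I. \<exists>n. (n, c) \<in> edges I) \<and>
     (\<forall>n\<in>voters I. 0 \<le> strength I n) \<and>
     0 < seats I \<and> seats I < card (cands I)"

definition cands_of :: "('v, 'c) election \<Rightarrow> 'v \<Rightarrow> 'c set" where
  "cands_of I n = {c. (n, c) \<in> edges I}"

definition voters_of :: "('v, 'c) election \<Rightarrow> 'c \<Rightarrow> 'v set" where
  "voters_of I c = {n. (n, c) \<in> edges I}"

text \<open>Weight vectors are functions on pairs; only their values on \<open>edges I\<close> matter.\<close>

definition feasible :: "('v, 'c) election \<Rightarrow> ('v \<times> 'c \<Rightarrow> real) \<Rightarrow> bool" where
  "feasible I w \<longleftrightarrow>
     (\<forall>e\<in>edges I. 0 \<le> w e) \<and>
     (\<forall>n\<in>voters I. (\<Sum>c\<in>cands_of I n. w (n, c)) \<le> strength I n)"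

definition supp :: "('v, 'c) election \<Rightarrow> ('v \<times> 'c \<Rightarrow> real) \<Rightarrow> 'c \<Rightarrow> real" where
  "supp I w c = (\<Sum>n\<in>voters_of I c. w (n, c))"

definition min_supp :: "('v, 'c) election \<Rightarrow> ('v \<times> 'c \<Rightarrow> real) \<Rightarrow> 'c set \<Rightarrow> real" where
  "min_supp I w A = Min (supp I w ` A)"

definition full_solution ::
    "('v, 'c) election \<Rightarrow> 'c set \<Rightarrow> ('v \<times> 'c \<Rightarrow> real) \<Rightarrow> bool" where
  "full_solution I A w \<longleftrightarrow> A \<subseteq> cands I \<and> card A = seats I \<and> feasible I w"

text \<open>The supremum is over a nonempty bounded set and is attained, so it is the optimal value.\<close>

definition opt :: "('v, 'c) election \<Rightarrow> real" where
  "opt I = Sup {min_supp I w A | A w. full_solution I A w}"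

definition approximation ::
    "real \<Rightarrow> ('v, 'c) election \<Rightarrow> 'c set \<Rightarrow> ('v \<times> 'c \<Rightarrow> real) \<Rightarrow> bool" where
  "approximation \<alpha> I A w \<longleftrightarrow> full_solution I A w \<and> min_supp I w A \<ge> opt I / \<alpha>"

definition balanced ::
    "('v, 'c) election \<Rightarrow> 'c set \<Rightarrow> ('v \<times> 'c \<Rightarrow> real) \<Rightarrow> bool" where
  "balanced I A w \<longleftrightarrow>
     is_arg_min (\<lambda>u. \<Sum>c\<in>A. (supp I u c)\<^sup>2)
       (is_arg_max (\<lambda>u. \<Sum>c\<in>A. supp I u c) (feasible I)) w"

definition PJR :: "('v, 'c) election \<Rightarrow> 'c set \<Rightarrow> bool" where
  "PJR I A \<longleftrightarrow>
     A \<subseteq> cands I \<and> card A = seats I \<and>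
     \<not> (\<exists>N' r. N' \<subseteq> voters I \<and> 0 < r \<and> r \<le> seats I \<and>
          (\<Sum>n\<in>N'. strength I n) \<ge> real r / real (seats I) * (\<Sum>n\<in>voters I. strength I n) \<and>
          card (\<Inter>n\<in>N'. cands_of I n) \<ge> r \<and>
          card (A \<inter> (\<Union>n\<in>N'. cands_of I n)) < r)"

text \<open>
  If all vote strengths vanish, the first condition on \<open>N'\<close> is void and there may be no
  committee with PJR at all; PJR can be guaranteed only when the total strength is positive.
\<close>

lemma PJR_unsatisfiable_without_votes:
  defines "I \<equiv> \<lparr>voters = {0, 1}, cands = {0, 1}, edges = {(0, 0), (1, 1)},
                strength = (\<lambda>_. 0), seats = 1\<rparr> :: (nat, nat) election"
  shows "election_instance I" and "\<not> PJR I A"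
proof -
  show "election_instance I"
    by (auto simp: election_instance_def I_def)
  show "\<not> PJR I A"
  proof
    assume PJR: "PJR I A"
    then have "A \<subseteq> {0, 1}" "card A = 1"
      by (auto simp: PJR_def I_def)
    then obtain n where n: "n \<in> {0, 1}" "n \<notin> A"
      by (metis card_1_singletonE insertCI singletonD zero_neq_one)
    have "cands_of I n = {n}"
      using n(1) by (auto simp: cands_of_def I_def)
    with n have "\<exists>N' r. N' \<subseteq> voters I \<and> 0 < r \<and> r \<le> seats I \<and>
          (\<Sum>n\<in>N'. strength I n) \<ge> real r / real (seats I) * (\<Sum>n\<in>voters I. strength I n) \<and>
          card (\<Inter>n\<in>N'. cands_of I n) \<ge> r \<and>
          card (A \<inter> (\<Union>n\<in>N'. cands_of I n)) < r"
      by (intro exI[of _ "{n}"] exI[of _ 1]) (auto simp: I_def)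
    with PJR show False
      unfolding PJR_def by blast
  qed
qed

section \<open>A real-number random access machine with a subroutine\<close>

text \<open>
  Memory consists of named arrays of natural numbers and named arrays of reals; a scalar is
  cell 0 of an array. There are no real constants other than those denoted by natural numbers
  and no conversion from reals to naturals.
\<close>

type_synonym name = string

record store =
  nats :: "name \<Rightarrow> nat \<Rightarrow> nat"
  reals :: "name \<Rightarrow> nat \<Rightarrow> real"

datatype nexp =
    NConst nat
  | NGet name nexp
  | NAdd nexp nexp
  | NSub nexp nexp

datatype rexp =
    RNat nexp
  | RGet name nexp
  | RAdd rexp rexp
  | RSub rexp rexp
  | RMul rexp rexp
  | RDiv rexp rexp

datatype bexp =
    NLess nexp nexp
  | RLess rexp rexp
  | BNot bexp
  | BAnd bexp bexp

datatype prog =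
    Skip
  | NSet name nexp nexp
  | RSet name nexp rexp
  | Seq prog prog
  | Cond bexp prog prog
  | While bexp prog
  | Call name name

fun nval :: "nexp \<Rightarrow> store \<Rightarrow> nat" where
  "nval (NConst m) s = m"
| "nval (NGet x i) s = nats s x (nval i s)"
| "nval (NAdd a b) s = nval a s + nval b s"
| "nval (NSub a b) s = nval a s - nval b s"

fun rval :: "rexp \<Rightarrow> store \<Rightarrow> real" where
  "rval (RNat a) s = real (nval a s)"
| "rval (RGet x i) s = reals s x (nval i s)"
| "rval (RAdd a b) s = rval a s + rval b s"
| "rval (RSub a b) s = rval a s - rval b s"
| "rval (RMul a b) s = rval a s * rval b s"
| "rval (RDiv a b) s = rval a s / rval b s"

fun bval :: "bexp \<Rightarrow> store \<Rightarrow> bool" where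
  "bval (NLess a b) s \<longleftrightarrow> nval a s < nval b s"
| "bval (RLess a b) s \<longleftrightarrow> rval a s < rval b s"
| "bval (BNot a) s \<longleftrightarrow> \<not> bval a s"
| "bval (BAnd a b) s \<longleftrightarrow> bval a s \<and> bval b s"

definition nupd :: "name \<Rightarrow> nat \<Rightarrow> nat \<Rightarrow> store \<Rightarrow> store" where
  "nupd x i v s = s\<lparr>nats := (nats s)(x := (nats s x)(i := v))\<rparr>"

definition rupd :: "name \<Rightarrow> nat \<Rightarrow> real \<Rightarrow> store \<Rightarrow> store" where
  "rupd x i v s = s\<lparr>reals := (reals s)(x := (reals s x)(i := v))\<rparr>"

text \<open>
  \<open>exec f p s t s'\<close>: program \<open>p\<close> started in \<open>s\<close> halts in \<open>s'\<close> after \<open>t\<close> time units.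
  Every assignment and every test takes one time unit; the expressions evaluated in such a step
  are part of the fixed program text, so this counts numerical operations up to a factor that
  depends on the program only. \<open>Call x y\<close> runs the subroutine \<open>f\<close> on the array of naturals \<open>x\<close>
  and stores its result in the array of reals \<open>y\<close>; the second component of \<open>f\<close> is the time
  this takes.
\<close>

inductive exec ::
    "((nat \<Rightarrow> nat) \<Rightarrow> (nat \<Rightarrow> real) \<times> nat) \<Rightarrow> prog \<Rightarrow> store \<Rightarrow> nat \<Rightarrow> store \<Rightarrow> bool"
  for f where
  Skip: "exec f Skip s 1 s"
| NSet: "exec f (NSet x i a) s 1 (nupd x (nval i s) (nval a s) s)"
| RSet: "exec f (RSet x i a) s 1 (rupd x (nval i s) (rval a s) s)"
| Seq: "exec f p s t s' \<Longrightarrow> exec f q s' u s'' \<Longrightarrow> exec f (Seq p q) s (t + u) s''"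
| CondT: "bval b s \<Longrightarrow> exec f p s t s' \<Longrightarrow> exec f (Cond b p q) s (1 + t) s'"
| CondF: "\<not> bval b s \<Longrightarrow> exec f q s t s' \<Longrightarrow> exec f (Cond b p q) s (1 + t) s'"
| WhileF: "\<not> bval b s \<Longrightarrow> exec f (While b p) s 1 s"
| WhileT: "bval b s \<Longrightarrow> exec f p s t s' \<Longrightarrow> exec f (While b p) s' u s'' \<Longrightarrow>
    exec f (While b p) s (1 + t + u) s''"
| Call: "f (nats s x) = (r, t) \<Longrightarrow> exec f (Call x y) s t (s\<lparr>reals := (reals s)(y := r)\<rparr>)"

lemma exec_deterministic:
  "exec f p s t s' \<Longrightarrow> exec f p s u s'' \<Longrightarrow> t = u \<and> s' = s''"
proof (induction arbitrary: u s'' rule: exec.induct)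
  case (Skip s)
  then show ?case by (auto elim: exec.cases)
next
  case (NSet x i a s)
  then show ?case by (auto elim: exec.cases)
next
  case (RSet x i a s)
  then show ?case by (auto elim: exec.cases)
next
  case (Seq p s t s1 q v s2)
  from Seq.prems show ?case
    by cases (use Seq.IH in blast)
next
  case (CondT b s p t s' q)
  from CondT.prems show ?case
    by cases (use CondT in blast)+
next
  case (CondF b s q t s' p)
  from CondF.prems show ?case
    by cases (use CondF in blast)+
next
  case (WhileF b s p)
  from WhileF.prems show ?case
    by cases (use WhileF in auto)
next
  case (WhileT b s p t s1 v s2)
  from WhileT.prems show ?case
    by cases (use WhileT in blast)+
next
  case (Call s x r t y)
  from Call.prems show ?case
    by cases (use Call in auto)
qed

section \<open>Input, output and the balancing subroutine\<close>

text \<open>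
  An instance is presented as an edge list: voters, candidates and edges are numbered by
  duplicate-free lists \<open>vs\<close>, \<open>cs\<close>, \<open>es\<close>, and the machine only sees the numbers.
\<close>

definition enumerates ::
    "('v, 'c) election \<Rightarrow> 'v list \<Rightarrow> 'c list \<Rightarrow> ('v \<times> 'c) list \<Rightarrow> bool" where
  "enumerates I vs cs es \<longleftrightarrow>
     distinct vs \<and> set vs = voters I \<and>
     distinct cs \<and> set cs = cands I \<and>
     distinct es \<and> set es = edges I"

text \<open>The contents of all cells not mentioned here are arbitrary.\<close>

definition input_store ::
    "('v, 'c) election \<Rightarrow> 'v list \<Rightarrow> 'c list \<Rightarrow> ('v \<times> 'c) list \<Rightarrow> real \<Rightarrow> store \<Rightarrow> bool" where
  "input_store I vs cs es \<epsilon> s \<longleftrightarrow>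
     nats s ''numvoters'' 0 = length vs \<and>
     nats s ''numcands'' 0 = length cs \<and>
     nats s ''numedges'' 0 = length es \<and>
     nats s ''seats'' 0 = seats I \<and>
     (\<forall>j<length es.
        nats s ''voter'' j < length vs \<and> nats s ''cand'' j < length cs \<and>
        es ! j = (vs ! nats s ''voter'' j, cs ! nats s ''cand'' j)) \<and>
     (\<forall>i<length vs. reals s ''strength'' i = strength I (vs ! i)) \<and>
     reals s ''eps'' 0 = \<epsilon>"

definition decode_cands :: "'c list \<Rightarrow> (nat \<Rightarrow> nat) \<Rightarrow> 'c set" where
  "decode_cands cs a = {cs ! i | i. i < length cs \<and> a i \<noteq> 0}"

definition output_store ::
    "'c list \<Rightarrow> ('v \<times> 'c) list \<Rightarrow> 'c set \<Rightarrow> ('v \<times> 'c \<Rightarrow> real) \<Rightarrow> store \<Rightarrow> bool" where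
  "output_store cs es A w s \<longleftrightarrow>
     A = decode_cands cs (nats s ''committee'') \<and>
     (\<forall>j<length es. w (es ! j) = reals s ''weight'' j)"

text \<open>
  A procedure that finds the weight vector \<open>solve A\<close> for the committee \<open>A\<close> in \<open>time A\<close> steps and
  then writes out its entries, one step per edge.
\<close>

definition subroutine ::
    "'c list \<Rightarrow> ('v \<times> 'c) list \<Rightarrow> ('c set \<Rightarrow> 'v \<times> 'c \<Rightarrow> real) \<Rightarrow> ('c set \<Rightarrow> nat) \<Rightarrow>
     (nat \<Rightarrow> nat) \<Rightarrow> (nat \<Rightarrow> real) \<times> nat" where
  "subroutine cs es solve time a =
     (let A = decode_cands cs a
      in (\<lambda>j. if j < length es then solve A (es ! j) else 0, time A + length es))"

text \<open>
  \<open>bal\<close> bounds the time of every call; committees under construction have at most \<open>seats I\<close>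
  members, and nothing is assumed about calls on larger sets.
\<close>

definition balancing_procedure ::
    "('v, 'c) election \<Rightarrow> ('c set \<Rightarrow> 'v \<times> 'c \<Rightarrow> real) \<Rightarrow> ('c set \<Rightarrow> nat) \<Rightarrow> real \<Rightarrow> bool" where
  "balancing_procedure I solve time bal \<longleftrightarrow>
     (\<forall>A. A \<subseteq> cands I \<and> card A \<le> seats I \<longrightarrow>
        balanced I A (solve A) \<and> real (time A + card (edges I)) \<le> bal)"

end

theory Submission
  imports Defs
begin

text \<open>
  A committee \<open>A\<close> admits a feasible weight vector giving every member support at least \<open>t\<close> iff
  \<open>s(N(X)) \<ge> t |X|\<close> for all \<open>X \<subseteq> A\<close>, and then every balanced vector is such a vector; call this
  \<open>hall A t\<close>. One call of the balancing procedure decides it.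

  Scan the candidates once, adding \<open>c\<close> to \<open>A\<close> whenever \<open>hall (A + c) t\<close>, until \<open>A\<close> has \<open>k\<close> members.
  If the scan ends with fewer than \<open>k\<close>, submodularity of \<open>X \<mapsto> s(N(X)) - t |X|\<close> shows that no
  committee of size \<open>k\<close> has value \<open>2 t\<close>. A bisection over \<open>t\<close> therefore yields factor \<open>2 + \<epsilon>\<close>, with
  \<open>O(log (1/\<epsilon>))\<close> scans once the optimum is known up to a constant factor. That factor (4) comes from
  \<open>k\<close> greedy steps in the manner of Phragmen, each using a single balanced vector.

  For PJR, every scan and the greedy phase start from the same set \<open>A0\<close>, the outcome of a scan with
  threshold \<open>S/k\<close>, where \<open>S\<close> is the total strength: a candidate witnessing a violation of PJR for any
  superset of \<open>A0\<close> could have been added to \<open>A0\<close>.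
\<close>

section \<open>Supports, balanced weights and a Hall condition\<close>

text \<open>The optimum can lie below S/k by an arbitrary factor, so a bisection started from S/k
  alone has no bound on its number of scans in terms of \<epsilon>; this is the obstacle that the
  greedy phase removes. Testing every candidate in every greedy round would take k |C| calls, so a
  round has to rank all candidates from one balanced vector, and the estimate then loses a factor 4
  instead of 2. Starting everything from \<open>A0\<close> costs nothing: no committee of size k has
  a value above S/k, so only thresholds up to S/k are tried, \<open>A0\<close> passes the test at
  each of them, and the comparison with a competitor never asks where the scan began. A single pass
  over the candidates is enough because \<open>hall\<close> is inherited by subsets: a rejected
  candidate stays rejected while \<open>A\<close> grows. In both estimates the competitor B enters
  only through its Hall condition and the inequality |A - B| < |B - A|, so two committees are
  compared by counting neighbours and no weight vector for B is ever handled.\<close>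

definition nbrs :: "('v, 'c) election \<Rightarrow> 'c set \<Rightarrow> 'v set" where
  "nbrs I X = (\<Union>c\<in>X. voters_of I c)"

text \<open>The cut condition for sending \<open>t\<close> units of strength to each member of
  \<open>A\<close>. The weight vector is eliminated from it, which makes sets comparable by their
  neighbourhoods alone.\<close>

definition hall :: "('v, 'c) election \<Rightarrow> 'c set \<Rightarrow> real \<Rightarrow> bool" where
  "hall I A t \<longleftrightarrow> (\<forall>X\<subseteq>A. t * real (card X) \<le> sum (strength I) (nbrs I X))"

lemma hallD: "hall I A t \<Longrightarrow> X \<subseteq> A \<Longrightarrow> t * real (card X) \<le> sum (strength I) (nbrs I X)"
  unfolding hall_def by blast

lemma hall_subset: "hall I A t \<Longrightarrow> B \<subseteq> A \<Longrightarrow> hall I B t"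
  unfolding hall_def by blast

lemma hall_antimono: "hall I A t \<Longrightarrow> t' \<le> t \<Longrightarrow> hall I A t'"
  unfolding hall_def by (meson mult_right_mono of_nat_0_le_iff order_trans)

lemma hall_insert_violation:
  assumes "hall I A t" "\<not> hall I (insert c A) t"
  obtains X where "c \<in> X" "X \<subseteq> insert c A" "sum (strength I) (nbrs I X) < t * real (card X)"
proof -
  from assms(2) obtain X where X: "X \<subseteq> insert c A" "\<not> t * real (card X) \<le> sum (strength I) (nbrs I X)"
    unfolding hall_def by blast
  moreover have "c \<in> X"
    using X assms(1) unfolding hall_def by (metis subset_insert)
  ultimately show ?thesis using that by simp
qed

lemma nbrs_mono: "X \<subseteq> Y \<Longrightarrow> nbrs I X \<subseteq> nbrs I Y"
  unfolding nbrs_def by blast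

lemma nbrs_Un: "nbrs I (X \<union> Y) = nbrs I X \<union> nbrs I Y"
  unfolding nbrs_def by blast

lemma nbrs_insert: "nbrs I (insert c X) = voters_of I c \<union> nbrs I X"
  unfolding nbrs_def by blast

lemma sum_UN_le:
  fixes f :: "'a \<Rightarrow> real"
  assumes "finite D" "\<And>c. c \<in> D \<Longrightarrow> finite (F c)" "\<And>c x. c \<in> D \<Longrightarrow> x \<in> F c \<Longrightarrow> 0 \<le> f x"
  shows "sum f (\<Union>c\<in>D. F c) \<le> (\<Sum>c\<in>D. sum f (F c))"
  using assms
proof (induction D rule: finite_induct)
  case (insert c D)
  have "sum f (F c \<union> (\<Union>c\<in>D. F c)) + sum f (F c \<inter> (\<Union>c\<in>D. F c)) = sum f (F c) + sum f (\<Union>c\<in>D. F c)"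
    using insert by (intro sum.union_inter) auto
  moreover have "0 \<le> sum f (F c \<inter> (\<Union>c\<in>D. F c))"
    using insert.prems by (intro sum_nonneg) auto
  moreover have "sum f (\<Union>c\<in>D. F c) \<le> (\<Sum>c\<in>D. sum f (F c))"
    using insert.IH insert.prems by blast
  ultimately show ?case using insert.hyps by simp
qed simp

section \<open>Finiteness, strength of voter sets, and supports\<close>

locale instance_of_election =
  fixes I :: "('v, 'c) election"
  assumes inst: "election_instance I"
begin

lemma finite_voters: "finite (voters I)" and finite_cands: "finite (cands I)"
  and edges_sub: "edges I \<subseteq> voters I \<times> cands I"
  and strength_nonneg: "n \<in> voters I \<Longrightarrow> 0 \<le> strength I n"
  and seats_pos: "0 < seats I" and seats_less: "seats I < card (cands I)"
  using inst unfolding election_instance_def by auto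

lemma finite_edges: "finite (edges I)"
  using edges_sub finite_voters finite_cands finite_subset by blast

lemma voters_of_sub: "voters_of I c \<subseteq> voters I"
  and cands_of_sub: "cands_of I n \<subseteq> cands I"
  and nbrs_sub: "nbrs I X \<subseteq> voters I"
  using edges_sub unfolding voters_of_def cands_of_def nbrs_def by auto

lemma finite_voters_of: "finite (voters_of I c)" and finite_cands_of: "finite (cands_of I n)"
  and finite_nbrs: "finite (nbrs I X)"
  using voters_of_sub cands_of_sub nbrs_sub finite_voters finite_cands finite_subset by metis+

text \<open>No vertex is isolated. As \<open>bal\<close> covers the writing of one entry per edge,
  this and the next lemma let every linear pass over candidates or voters be charged to
  \<open>bal\<close>.\<close>

lemma card_cands_le_edges: "card (cands I) \<le> card (edges I)"
proof -
  have "cands I \<subseteq> snd ` edges I"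
    using inst unfolding election_instance_def by force
  then show ?thesis
    using finite_edges by (meson card_image_le card_mono finite_imageI order_trans)
qed

lemma card_voters_le_edges: "card (voters I) \<le> card (edges I)"
proof -
  have "voters I \<subseteq> fst ` edges I"
    using inst unfolding election_instance_def by force
  then show ?thesis
    using finite_edges by (meson card_image_le card_mono finite_imageI order_trans)
qed

lemma sum_strength_mono:
  "M \<subseteq> N \<Longrightarrow> N \<subseteq> voters I \<Longrightarrow> sum (strength I) M \<le> sum (strength I) N"
  using strength_nonneg finite_voters
  by (intro sum_mono2) (auto intro: finite_subset)

lemma sum_strength_Un:
  assumes "M \<subseteq> voters I" "N \<subseteq> voters I"
  shows "sum (strength I) (M \<union> N) + sum (strength I) (M \<inter> N)
    = sum (strength I) M + sum (strength I) N"
  using assms finite_voters by (intro sum.union_inter) (auto intro: finite_subset)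

lemma hall_zero: "hall I A 0"
  unfolding hall_def using nbrs_sub strength_nonneg by (auto intro!: sum_nonneg)

lemma sum_supp:
  assumes "X \<subseteq> cands I"
  shows "(\<Sum>c\<in>X. supp I w c) = (\<Sum>n\<in>nbrs I X. \<Sum>c\<in>cands_of I n \<inter> X. w (n, c))"
proof -
  have "(\<Sum>c\<in>X. supp I w c) = (\<Sum>c\<in>X. \<Sum>n | n \<in> nbrs I X \<and> (n, c) \<in> edges I. w (n, c))"
    unfolding supp_def
    by (intro sum.cong refl) (auto simp: nbrs_def voters_of_def)
  also have "\<dots> = (\<Sum>n\<in>nbrs I X. \<Sum>c | c \<in> X \<and> (n, c) \<in> edges I. w (n, c))"
    using assms finite_cands finite_nbrs
    by (intro sum.swap_restrict) (auto intro: finite_subset)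
  also have "\<dots> = (\<Sum>n\<in>nbrs I X. \<Sum>c\<in>cands_of I n \<inter> X. w (n, c))"
    by (intro sum.cong refl) (auto simp: cands_of_def)
  finally show ?thesis .
qed

lemma feasible_partial_sum:
  assumes "feasible I w" "n \<in> voters I"
  shows "(\<Sum>c\<in>cands_of I n \<inter> X. w (n, c)) \<le> strength I n"
proof -
  have "(\<Sum>c\<in>cands_of I n \<inter> X. w (n, c)) \<le> (\<Sum>c\<in>cands_of I n. w (n, c))"
    using assms finite_cands_of unfolding feasible_def cands_of_def
    by (intro sum_mono2) auto
  with assms show ?thesis unfolding feasible_def by force
qed

text \<open>The easy half of Hall: the members of \<open>X\<close> are paid by
  \<open>nbrs I X\<close> only.\<close>

lemma hall_if_supp_ge:
  assumes "feasible I w" "A \<subseteq> cands I" "\<And>c. c \<in> A \<Longrightarrow> t \<le> supp I w c"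
  shows "hall I A t"
  unfolding hall_def
proof (intro allI impI)
  fix X assume X: "X \<subseteq> A"
  have "t * real (card X) = (\<Sum>c\<in>X. t)" by simp
  also have "\<dots> \<le> (\<Sum>c\<in>X. supp I w c)"
    using X assms(3) by (intro sum_mono) auto
  also have "\<dots> \<le> sum (strength I) (nbrs I X)"
    using X assms nbrs_sub[of X] by (subst sum_supp) (auto intro!: sum_mono feasible_partial_sum)
  finally show "t * real (card X) \<le> sum (strength I) (nbrs I X)" .
qed

section \<open>Exchange arguments for balanced vectors\<close>

lemma balanced_feasible: "balanced I A w \<Longrightarrow> feasible I w"
  unfolding balanced_def is_arg_min_def is_arg_max_def by auto

text \<open>Strength that \<open>n\<close> leaves unspent or spends outside \<open>A\<close> could
  go to \<open>c\<close> and raise the total support of \<open>A\<close>.\<close>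

lemma balanced_spends_all:
  assumes bal: "balanced I A w" and A: "A \<subseteq> cands I" and c: "c \<in> A" "(n, c) \<in> edges I"
  shows "(\<Sum>c\<in>cands_of I n \<inter> A. w (n, c)) = strength I n"
proof (rule ccontr)
  define \<delta> where "\<delta> = strength I n - (\<Sum>c\<in>cands_of I n \<inter> A. w (n, c))"
  assume neq: "\<not> ?thesis"
  have feas: "feasible I w" using bal by (rule balanced_feasible)
  have n: "n \<in> voters I" using c edges_sub by auto
  have pos: "\<delta> > 0"
    using feasible_partial_sum[OF feas n, of A] neq unfolding \<delta>_def by linarith
  \<comment> \<open>Dropping what \<open>n\<close> gives outside \<open>A\<close> makes room for
    \<delta>: the new total of \<open>n\<close> is exactly \<open>strength I n\<close>, and no
    support inside \<open>A\<close> decreases.\<close>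
  define u where "u = (\<lambda>(m, d). if m = n then (if d \<in> A then w (n, d) + (if d = c then \<delta> else 0) else 0)
      else w (m, d))"
  have "feasible I u"
    unfolding feasible_def
  proof (intro conjI ballI)
    fix e assume "e \<in> edges I"
    then show "0 \<le> u e"
      using feas pos unfolding feasible_def u_def by (auto split: prod.split)
  next
    fix m assume m: "m \<in> voters I"
    show "(\<Sum>d\<in>cands_of I m. u (m, d)) \<le> strength I m"
    proof (cases "m = n")
      case True
      have "(\<Sum>d\<in>cands_of I n. u (n, d)) = (\<Sum>d\<in>cands_of I n \<inter> A. u (n, d))"
        using finite_cands_of by (intro sum.mono_neutral_right) (auto simp: u_def)
      also have "\<dots> = (\<Sum>d\<in>cands_of I n \<inter> A. w (n, d) + (if d = c then \<delta> else 0))"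
        by (intro sum.cong) (auto simp: u_def)
      also have "\<dots> = strength I n"
        using c finite_cands_of[of n] by (simp add: sum.distrib \<delta>_def cands_of_def)
      finally show ?thesis using True by simp
    next
      case False
      then show ?thesis using feas m unfolding feasible_def u_def by simp
    qed
  qed
  moreover have "supp I u d = supp I w d + (if d = c then \<delta> else 0)" if "d \<in> A" for d
  proof -
    have "supp I u d = (\<Sum>m\<in>voters_of I d. w (m, d) + (if m = n then (if d = c then \<delta> else 0) else 0))"
      unfolding supp_def using that by (intro sum.cong) (auto simp: u_def)
    also have "\<dots> = supp I w d + (if n \<in> voters_of I d then (if d = c then \<delta> else 0) else 0)"
      using finite_voters_of by (simp add: sum.distrib supp_def)
    finally show ?thesis using c by (auto simp: voters_of_def)
  qed
  then have "(\<Sum>d\<in>A. supp I u d) = (\<Sum>d\<in>A. supp I w d) + \<delta>"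
    using c finite_subset[OF A finite_cands] by (simp add: sum.distrib)
  then have "(\<Sum>d\<in>A. supp I u d) > (\<Sum>d\<in>A. supp I w d)" using pos by linarith
  ultimately show False
    using bal unfolding balanced_def is_arg_min_def is_arg_max_def by blast
qed

text \<open>Moving a little weight of \<open>n\<close> from \<open>c\<close> to a less supported
  \<open>d\<close> keeps the total support and lowers the sum of squares.\<close>

lemma balanced_spends_on_least:
  assumes bal: "balanced I A w" and A: "A \<subseteq> cands I"
    and c: "c \<in> A" "(n, c) \<in> edges I" and d: "d \<in> A" "(n, d) \<in> edges I"
    and w: "w (n, c) \<noteq> 0"
  shows "supp I w c \<le> supp I w d"
proof (rule ccontr)
  assume less: "\<not> ?thesis"
  then have cd: "c \<noteq> d" by auto
  have feas: "feasible I w" using bal by (rule balanced_feasible)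
  have n: "n \<in> voters I" using c edges_sub by auto
  have finA: "finite A" using A finite_cands finite_subset by blast
  have w: "w (n, c) > 0" using w feas c unfolding feasible_def by force
  \<comment> \<open>The first bound keeps the weight of \<open>c\<close> nonnegative. The second
    keeps \<delta> below the gap between the two supports, so that the sum of squares changes by the
    negative amount -2 \<delta> (gap - \<delta>).\<close>
  define \<delta> where "\<delta> = min (w (n, c)) ((supp I w c - supp I w d) / 2)"
  have \<delta>: "\<delta> > 0" "\<delta> \<le> w (n, c)" "\<delta> < supp I w c - supp I w d"
    using less w unfolding \<delta>_def by (auto simp: min_less_iff_disj)
  define g where "g = (\<lambda>x. if x = c then - \<delta> else if x = d then \<delta> else 0)"
  define u where "u = (\<lambda>(m, x). w (m, x) + (if m = n then g x else 0))"
  have g: "sum g B = 0" if "finite B" "c \<in> B" "d \<in> B" for B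
  proof -
    have "sum g B = sum g {c, d}"
      using that by (intro sum.mono_neutral_right) (auto simp: g_def)
    then show ?thesis using cd by (simp add: g_def)
  qed
  have feas_u: "feasible I u"
    unfolding feasible_def
  proof (intro conjI ballI)
    fix e assume "e \<in> edges I"
    then have "0 \<le> w e" using feas unfolding feasible_def by auto
    then show "0 \<le> u e" using \<delta> by (auto simp: u_def g_def split: prod.split)
  next
    fix m assume m: "m \<in> voters I"
    have "(\<Sum>x\<in>cands_of I m. u (m, x)) = (\<Sum>x\<in>cands_of I m. w (m, x)) + (if m = n then sum g (cands_of I n) else 0)"
      by (auto simp: u_def sum.distrib)
    also have "\<dots> = (\<Sum>x\<in>cands_of I m. w (m, x))"
      using g[of "cands_of I n"] c d finite_cands_of by (simp add: cands_of_def)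
    finally show "(\<Sum>x\<in>cands_of I m. u (m, x)) \<le> strength I m"
      using feas m unfolding feasible_def by auto
  qed
  have supp_u: "supp I u x = supp I w x + g x" for x
  proof -
    have "supp I u x = supp I w x + (if n \<in> voters_of I x then g x else 0)"
      unfolding supp_def u_def using finite_voters_of by (simp add: sum.distrib)
    then show ?thesis using c d by (auto simp: voters_of_def g_def)
  qed
  have "(\<Sum>x\<in>A. supp I u x) = (\<Sum>x\<in>A. supp I w x)"
    using g[OF finA c(1) d(1)] by (simp add: supp_u sum.distrib)
  then have max_u: "is_arg_max (\<lambda>u. \<Sum>c\<in>A. supp I u c) (feasible I) u"
    using bal feas_u unfolding balanced_def is_arg_min_def is_arg_max_def by auto
  have "(\<Sum>x\<in>A. (supp I u x)\<^sup>2) = (\<Sum>x\<in>A. (supp I w x)\<^sup>2 + (2 * g x * supp I w x + (g x)\<^sup>2))"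
    by (intro sum.cong) (auto simp: supp_u power2_eq_square algebra_simps)
  also have "\<dots> = (\<Sum>x\<in>A. (supp I w x)\<^sup>2) + (\<Sum>x\<in>A. 2 * g x * supp I w x + (g x)\<^sup>2)"
    by (rule sum.distrib)
  also have "(\<Sum>x\<in>A. 2 * g x * supp I w x + (g x)\<^sup>2) = (\<Sum>x\<in>{c, d}. 2 * g x * supp I w x + (g x)\<^sup>2)"
    using finA c d by (intro sum.mono_neutral_right) (auto simp: g_def)
  also have "\<dots> = - 2 * (\<delta> * (supp I w c - supp I w d - \<delta>))"
    using cd by (simp add: g_def power2_eq_square algebra_simps)
  also have "\<dots> < 0" using \<delta> by simp
  finally have "(\<Sum>x\<in>A. (supp I u x)\<^sup>2) < (\<Sum>x\<in>A. (supp I w x)\<^sup>2)" by simp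
  then show False
    using bal max_u unfolding balanced_def is_arg_min_def by blast
qed

text \<open>A voter approving a member of support at most \<open>t\<close> spends everything on such members.\<close>

lemma strength_of_low_nbrs:
  fixes t :: real
  assumes bal: "balanced I A w" and A: "A \<subseteq> cands I"
  defines "L \<equiv> {c \<in> A. supp I w c \<le> t}"
  shows "sum (strength I) (nbrs I L) = (\<Sum>c\<in>L. supp I w c)"
proof -
  have "(\<Sum>c\<in>cands_of I n \<inter> L. w (n, c)) = strength I n" if n: "n \<in> nbrs I L" for n
  proof -
    from n obtain c where c: "c \<in> A" "supp I w c \<le> t" "(n, c) \<in> edges I"
      by (auto simp: nbrs_def L_def voters_of_def)
    have "w (n, d) = 0" if d: "d \<in> cands_of I n \<inter> A - cands_of I n \<inter> L" for d
      using balanced_spends_on_least[OF bal A, of d n c] d c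
      by (force simp: cands_of_def L_def)
    then have "(\<Sum>c\<in>cands_of I n \<inter> A. w (n, c)) = (\<Sum>c\<in>cands_of I n \<inter> L. w (n, c))"
      using finite_cands_of by (intro sum.mono_neutral_right) (auto simp: L_def)
    with balanced_spends_all[OF bal A c(1,3)] show ?thesis by simp
  qed
  moreover have "L \<subseteq> cands I" using A by (auto simp: L_def)
  ultimately show ?thesis by (simp add: sum_supp)
qed

text \<open>The hard half of Hall, drawn from balancedness in place of a max-flow argument: the
  neighbours of the least supported members \<open>L\<close> spend everything on \<open>L\<close>,
  so their strength is at most \<open>m * card L\<close>, and the cut condition for this one set
  forces t \<le> m.\<close>

lemma balanced_supp_ge:
  assumes bal: "balanced I A w" and A: "A \<subseteq> cands I" and hall: "hall I A t" and c: "c \<in> A"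
  shows "t \<le> supp I w c"
proof -
  have finA: "finite A" using A finite_cands finite_subset by blast
  define m where "m = Min (supp I w ` A)"
  have m: "m \<le> supp I w d" if "d \<in> A" for d
    using that finA by (simp add: m_def)
  define L where "L = {c \<in> A. supp I w c \<le> m}"
  have "m \<in> supp I w ` A" unfolding m_def using finA c by (intro Min_in) auto
  then have "L \<noteq> {}" by (auto simp: L_def)
  then have cL: "card L > 0" using finA by (auto simp: L_def card_gt_0_iff)
  have "t * card L \<le> sum (strength I) (nbrs I L)"
    using hallD[OF hall] by (simp add: L_def)
  also have "\<dots> = (\<Sum>c\<in>L. supp I w c)"
    unfolding L_def by (rule strength_of_low_nbrs[OF bal A])
  also have "\<dots> \<le> (\<Sum>c\<in>L. m)" by (intro sum_mono) (simp add: L_def)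
  also have "\<dots> = m * card L" by simp
  finally have "t \<le> m" using cL by simp
  with m[OF c] show ?thesis by simp
qed

lemma hall_iff_supp_ge:
  assumes "balanced I A w" "A \<subseteq> cands I"
  shows "hall I A t \<longleftrightarrow> (\<forall>c\<in>A. t \<le> supp I w c)"
  using assms balanced_supp_ge hall_if_supp_ge balanced_feasible by metis

section \<open>Submodularity and the factor 2\<close>

text \<open>
  The function \<open>X \<mapsto> s(N(X)) - t|X|\<close> is submodular, so the violations for the single
  candidates \<open>c \<in> B - A\<close> add up to one for a set containing \<open>B - A\<close>.
\<close>

lemma extension_violation:
  assumes "hall I A t" "A \<subseteq> cands I" "finite D" "D \<noteq> {}" "D \<subseteq> cands I" "D \<inter> A = {}"
    and "\<And>c. c \<in> D \<Longrightarrow> \<not> hall I (insert c A) t"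
  shows "\<exists>Y\<subseteq>A. sum (strength I) (nbrs I (Y \<union> D)) < t * real (card (Y \<union> D))"
  using assms(3-7)
proof (induction D rule: finite_ne_induct)
  case (singleton c)
  then obtain X where "c \<in> X" and X: "X \<subseteq> insert c A" "sum (strength I) (nbrs I X) < t * real (card X)"
    using hall_insert_violation[OF assms(1)] by (metis insertI1)
  then have "X = (X - {c}) \<union> {c}" by blast
  then show ?case using X by (metis Diff_subset_conv insert_is_Un)
next
  case (insert c D)
  from insert obtain Y where Y: "Y \<subseteq> A"
    "sum (strength I) (nbrs I (Y \<union> D)) < t * real (card (Y \<union> D))" by auto
  have "\<not> hall I (insert c A) t" using insert.prems by simp
  then obtain X where cX: "c \<in> X"
    and X: "X \<subseteq> insert c A" "sum (strength I) (nbrs I X) < t * real (card X)"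
    using hall_insert_violation[OF assms(1)] by metis
  define P where "P = Y \<union> D"
  \<comment> \<open>Since \<open>c\<close> is not in \<open>D\<close>, the two violating sets meet
    only inside \<open>A\<close>. The intersection therefore obeys \<open>hall\<close>, and
    submodularity passes the violations on to the union.\<close>
  have sub: "P \<inter> X \<subseteq> A" using X(1) Y(1) insert.hyps insert.prems by (auto simp: P_def)
  then have 1: "t * real (card (P \<inter> X)) \<le> sum (strength I) (nbrs I (P \<inter> X))"
    using hallD[OF assms(1)] by blast
  have fin: "finite P" "finite X"
    using Y(1) X(1) assms(2) insert.hyps finite_cands
    by (auto simp: P_def intro: finite_subset[of _ "insert c A"] finite_subset[of _ A] finite_subset[of A "cands I"])
  have "sum (strength I) (nbrs I (P \<union> X)) + sum (strength I) (nbrs I (P \<inter> X))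
      \<le> sum (strength I) (nbrs I P \<union> nbrs I X) + sum (strength I) (nbrs I P \<inter> nbrs I X)"
    unfolding nbrs_Un
    using nbrs_sub by (intro add_mono sum_strength_mono) (auto simp: nbrs_def)
  also have "\<dots> = sum (strength I) (nbrs I P) + sum (strength I) (nbrs I X)"
    using nbrs_sub by (intro sum_strength_Un)
  also have "\<dots> < t * real (card P) + t * real (card X)"
    using X Y unfolding P_def by linarith
  also have "\<dots> = t * real (card (P \<union> X)) + t * real (card (P \<inter> X))"
    using card_Un_Int[OF fin] by (metis distrib_left of_nat_add)
  finally have "sum (strength I) (nbrs I (P \<union> X)) < t * real (card (P \<union> X))"
    using 1 by linarith
  moreover have "P \<union> X = (Y \<union> (X - {c})) \<union> insert c D" using cX by (auto simp: P_def)
  moreover have "Y \<union> (X - {c}) \<subseteq> A" using X(1) Y(1) by auto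
  ultimately show ?case by metis
qed

text \<open>The origin of the factor 2. In the violating set \<open>Y \<union> (B - A)\<close> the
  part outside \<open>B\<close> has at most |A - B| < |B - A| members, so at least half of the set
  lies in \<open>B\<close>. If that half had strength \<open>2 * t\<close> per member, the whole set
  would have \<open>t\<close> per member.\<close>

lemma maximal_half_optimal:
  assumes hall: "hall I A t" and A: "A \<subseteq> cands I" "card A < seats I" and t: "0 \<le> t"
    and max: "\<And>c. c \<in> cands I - A \<Longrightarrow> \<not> hall I (insert c A) t"
    and B: "B \<subseteq> cands I" "card B = seats I"
  shows "\<not> hall I B (2 * t)"
proof
  assume hB: "hall I B (2 * t)"
  have fin: "finite A" "finite B" using A B finite_cands finite_subset by blast+
  have D: "card (A - B) < card (B - A)" using card_less_sym_Diff[OF fin] A B by simp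
  then have "B - A \<noteq> {}" by (metis card.empty not_less_zero)
  then obtain Y where Y: "Y \<subseteq> A"
    "sum (strength I) (nbrs I (Y \<union> (B - A))) < t * real (card (Y \<union> (B - A)))"
    using extension_violation[OF hall A(1), of "B - A"] max B fin by auto
  have finY: "finite Y" using Y fin finite_subset by blast
  let ?Z = "(Y \<inter> B) \<union> (B - A)"
  have "2 * t * real (card ?Z) \<le> sum (strength I) (nbrs I ?Z)"
    by (intro hallD[OF hB]) auto
  also have "\<dots> \<le> sum (strength I) (nbrs I (Y \<union> (B - A)))"
    using nbrs_sub by (intro sum_strength_mono nbrs_mono) auto
  also note Y(2)
  finally have less: "t * (2 * real (card ?Z)) < t * real (card (Y \<union> (B - A)))" by (simp add: mult_ac)
  have "card ?Z = card (Y \<inter> B) + card (B - A)"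
    using Y fin by (intro card_Un_disjoint) auto
  moreover have "card (Y \<union> (B - A)) \<le> card Y + card (B - A)" by (rule card_Un_le)
  moreover have "card Y \<le> card (Y \<inter> B) + card (Y - B)"
    using card_Un_le[of "Y \<inter> B" "Y - B"] by (simp add: Int_Diff_Un)
  moreover have "card (Y - B) \<le> card (A - B)" using Y fin by (intro card_mono) auto
  ultimately have "real (card (Y \<union> (B - A))) \<le> 2 * real (card ?Z)" using D by linarith
  with less t show False by (meson linorder_not_less mult_left_mono)
qed

section \<open>The quota and PJR\<close>

definition quota :: real where
  "quota = sum (strength I) (voters I) / real (seats I)"

lemma quota_nonneg: "0 \<le> quota"
  unfolding quota_def using strength_nonneg by (simp add: sum_nonneg)

lemma hall_le_quota:
  assumes "hall I B t" "B \<subseteq> cands I" "card B = seats I"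
  shows "t \<le> quota"
proof -
  have "t * seats I \<le> sum (strength I) (nbrs I B)"
    using hallD[OF assms(1)] assms(3) by fastforce
  also have "\<dots> \<le> sum (strength I) (voters I)"
    using nbrs_sub by (intro sum_strength_mono) auto
  finally show ?thesis using seats_pos unfolding quota_def by (simp add: field_simps)
qed

text \<open>In the maximal case a set that violates the cut condition for \<open>insert c A0\<close>
  contains \<open>c\<close>, so all of \<open>N'\<close> are among its neighbours. They pay for
  \<open>r\<close> members, while at most \<open>r\<close> members of the set, \<open>c\<close>
  included, are approved in \<open>N'\<close>; the other members have neighbours outside
  \<open>N'\<close> to pay for them. With \<open>quota = 0\<close> the cut conditions say nothing,
  hence the positive total strength.\<close>

lemma PJR_if_quota_maximal:
  assumes pos: "0 < sum (strength I) (voters I)"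
    and hall: "hall I A0 quota"
    and max: "card A0 = seats I \<or> (\<forall>c\<in>cands I - A0. \<not> hall I (insert c A0) quota)"
    and A: "A0 \<subseteq> A" "A \<subseteq> cands I" "card A = seats I"
  shows "PJR I A"
  unfolding PJR_def
proof (intro conjI notI A, elim exE conjE)
  fix N' r
  assume N': "N' \<subseteq> voters I" and r: "0 < r" "r \<le> seats I"
    and large: "real r / real (seats I) * sum (strength I) (voters I) \<le> sum (strength I) N'"
    and cohesive: "r \<le> card (\<Inter>n\<in>N'. cands_of I n)"
    and unrep: "card (A \<inter> (\<Union>n\<in>N'. cands_of I n)) < r"
  let ?U = "\<Union>n\<in>N'. cands_of I n"
  have finA: "finite A" using A finite_cands finite_subset by blast
  then have finA0: "finite A0" using A finite_subset by blast
  have large: "real r * quota \<le> sum (strength I) N'"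
    using large unfolding quota_def by (simp add: field_simps)
  have qpos: "0 < quota" using pos seats_pos unfolding quota_def by simp
  \<comment> \<open>The intersection over an empty group would be the whole type, so this case is
    excluded before intersection and union are compared.\<close>
  have "N' \<noteq> {}" using large r qpos by (auto simp: mult_le_0_iff)
  then have "A \<inter> (\<Inter>n\<in>N'. cands_of I n) \<subseteq> A \<inter> ?U" by blast
  then have "card (A \<inter> (\<Inter>n\<in>N'. cands_of I n)) < card (\<Inter>n\<in>N'. cands_of I n)"
    using unrep cohesive finA by (meson card_mono finite_Int le_less_trans less_le_trans)
  then have "\<not> (\<Inter>n\<in>N'. cands_of I n) \<subseteq> A" by (metis inf.absorb_iff2 less_irrefl)
  then obtain c where c: "c \<notin> A" "\<And>n. n \<in> N' \<Longrightarrow> c \<in> cands_of I n" by blast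
  have far: "nbrs I X \<inter> N' = {}" if "X \<inter> ?U = {}" for X
    using that by (auto simp: nbrs_def voters_of_def cands_of_def)
  have cX: "card (X \<inter> ?U) < r" if "X \<subseteq> A" for X
    using unrep card_mono[of "A \<inter> ?U" "X \<inter> ?U"] that finA by (meson finite_Int inf_mono le_less_trans order_refl)
  have split: "card X = card (X \<inter> ?U) + card (X - ?U)" if "X \<subseteq> A" for X
    using that finA by (metis card_Int_Diff finite_subset)
  show False
  proof (cases "card A0 = seats I")
    case True
    then have eq: "A0 = A" using A finA by (simp add: card_subset_eq)
    \<comment> \<open>No candidate can be added here. Instead more than k - r members lie outside
      \<open>?U\<close>, and only the strength outside \<open>N'\<close> pays for them, which is at
      most k - r quotas.\<close>
    have "quota * real (card (A - ?U)) \<le> sum (strength I) (nbrs I (A - ?U))"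
      using hallD[OF hall] unfolding eq by blast
    also have "\<dots> = sum (strength I) (nbrs I (A - ?U) \<union> N') - sum (strength I) N'"
      using sum_strength_Un[OF nbrs_sub N', of "A - ?U"] far[of "A - ?U"] by (simp add: Diff_Int_distrib2)
    also have "\<dots> \<le> sum (strength I) (voters I) - real r * quota"
      using sum_strength_mono[of "nbrs I (A - ?U) \<union> N'" "voters I"] nbrs_sub N' large by (intro diff_mono) auto
    also have "sum (strength I) (voters I) = quota * real (seats I)"
      using seats_pos by (simp add: quota_def)
    finally have "quota * real (card (A - ?U) + r) \<le> quota * real (seats I)" by (simp add: algebra_simps)
    then have "card (A - ?U) + r \<le> seats I" using qpos by simp
    then show False using split[of A] cX[of A] A by simp
  next
    case False
    have "c \<in> cands I" using c(2) \<open>N' \<noteq> {}\<close> cands_of_sub by blast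
    then have "\<not> hall I (insert c A0) quota" using max False c A by blast
    then obtain X where cX': "c \<in> X"
      and X: "X \<subseteq> insert c A0" "sum (strength I) (nbrs I X) < quota * real (card X)"
      using hall_insert_violation[OF hall] by metis
    define Y where "Y = X - {c}"
    have Y: "Y \<subseteq> A0" "Y \<subseteq> A" using X(1) A by (auto simp: Y_def)
    have cardX: "card X = card Y + 1"
      using cX' X(1) finA0 unfolding Y_def
      by (metis Suc_eq_plus1 card.remove finite_insert finite_subset)
    have "real r * quota + quota * real (card (Y - ?U)) \<le> sum (strength I) N' + sum (strength I) (nbrs I (Y - ?U))"
      using large hallD[OF hall, of "Y - ?U"] Y(1) by (intro add_mono) auto
    also have "\<dots> = sum (strength I) (N' \<union> nbrs I (Y - ?U))"
      using sum_strength_Un[OF nbrs_sub N', of "Y - ?U"] far[of "Y - ?U"]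
      by (simp add: Diff_Int_distrib2 Un_commute)
    also have "\<dots> \<le> sum (strength I) (nbrs I X)"
      using nbrs_sub cX' c(2) by (intro sum_strength_mono) (auto simp: nbrs_def Y_def voters_of_def cands_of_def)
    also note X(2)
    finally have "quota * real (r + card (Y - ?U)) < quota * real (card X)" by (simp add: algebra_simps)
    then have "r + card (Y - ?U) < card X" using qpos by simp
    then show False using split[of Y] cX[of Y] Y cardX by simp
  qed
qed

section \<open>Greedy scores and the factor 4\<close>

text \<open>
  If all supports in \<open>A\<close> are scaled down to \<open>t\<close>, voter \<open>n\<close> still spends \<open>t * load n\<close>; the score of \<open>c\<close>
  is the \<open>t\<close> for which the strength thereby freed among the approvers of \<open>c\<close> is exactly \<open>t\<close>.
\<close>

definition load :: "'c set \<Rightarrow> ('v \<times> 'c \<Rightarrow> real) \<Rightarrow> 'v \<Rightarrow> real" where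
  "load A w n = (\<Sum>c\<in>cands_of I n \<inter> A. w (n, c) / supp I w c)"

definition score :: "'c set \<Rightarrow> ('v \<times> 'c \<Rightarrow> real) \<Rightarrow> 'c \<Rightarrow> real" where
  "score A w c = (\<Sum>n\<in>voters_of I c. strength I n) / (1 + (\<Sum>n\<in>voters_of I c. load A w n))"

lemma supp_nonneg: "feasible I w \<Longrightarrow> 0 \<le> supp I w c"
  unfolding supp_def feasible_def voters_of_def by (intro sum_nonneg) auto

lemma load_nonneg: "feasible I w \<Longrightarrow> 0 \<le> load A w n"
  unfolding load_def using supp_nonneg
  by (intro sum_nonneg divide_nonneg_nonneg) (auto simp: feasible_def cands_of_def)

lemma sum_load_nonneg: "feasible I w \<Longrightarrow> 0 \<le> (\<Sum>n\<in>voters_of I c. load A w n)"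
  using load_nonneg by (intro sum_nonneg)

lemma score_nonneg: "feasible I w \<Longrightarrow> 0 \<le> score A w c"
  unfolding score_def using sum_load_nonneg[of w A c] voters_of_sub strength_nonneg
  by (intro divide_nonneg_nonneg sum_nonneg) auto

lemma load_le:
  assumes "feasible I w" "n \<in> voters I" "0 < t" "\<And>c. c \<in> cands_of I n \<inter> A \<Longrightarrow> t \<le> supp I w c"
  shows "t * load A w n \<le> strength I n"
proof -
  have "t * load A w n = (\<Sum>c\<in>cands_of I n \<inter> A. w (n, c) * (t / supp I w c))"
    unfolding load_def sum_distrib_left by (simp add: mult_ac)
  also have "\<dots> \<le> (\<Sum>c\<in>cands_of I n \<inter> A. w (n, c))"
    using assms by (intro sum_mono mult_left_le) (force simp: feasible_def cands_of_def)+
  also have "\<dots> \<le> strength I n" using assms by (intro feasible_partial_sum)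
  finally show ?thesis .
qed

text \<open>The rescaled vector is not built; its cut condition is counted. The set \<open>Y\<close>
  costs \<open>t\<close> times the loads of its neighbours. By \<open>num\<close> the approvers of
  \<open>c\<close> can pay their loads and \<open>t\<close> in addition, and by \<open>load\<close>
  every other voter can pay its own load.\<close>

lemma hall_insert_if_score_ge:
  assumes feas: "feasible I w" and A: "A \<subseteq> cands I" and t: "0 < t"
    and supp: "\<And>d. d \<in> A \<Longrightarrow> t \<le> supp I w d" and score: "t \<le> score A w c"
  shows "hall I (insert c A) t"
  unfolding hall_def
proof (intro allI impI)
  fix X assume X: "X \<subseteq> insert c A"
  have hallA: "hall I A t" using hall_if_supp_ge feas A supp by blast
  show "t * real (card X) \<le> sum (strength I) (nbrs I X)"
  proof (cases "c \<in> X")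
    case False
    then show ?thesis using X hallD[OF hallA] by blast
  next
    case True
    define Y where "Y = X - {c}"
    have Y: "Y \<subseteq> A" "Y \<subseteq> cands I" "finite Y" using X A finite_cands by (auto simp: Y_def intro: finite_subset)
    have XY: "X = insert c Y" "c \<notin> Y" using True by (auto simp: Y_def)
    have load: "t * load A w n \<le> strength I n" if "n \<in> voters I" for n
      using load_le[OF feas that t] supp by blast
    have num: "t * (1 + (\<Sum>n\<in>voters_of I c. load A w n)) \<le> (\<Sum>n\<in>voters_of I c. strength I n)"
      using score sum_load_nonneg[OF feas, of A c] unfolding score_def by (simp add: pos_le_divide_eq)
    \<comment> \<open>Normalised weights give each member of \<open>Y\<close> support one, so the
      loads of the neighbours of \<open>Y\<close> add up to at least its size.\<close>
    have "real (card Y) = (\<Sum>d\<in>Y. supp I (\<lambda>(n, d). w (n, d) / supp I w d) d)"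
    proof -
      have "supp I (\<lambda>(n, d). w (n, d) / supp I w d) d = 1" if "d \<in> Y" for d
      proof -
        have "supp I w d > 0" using supp[of d] that Y t by auto
        moreover have "supp I (\<lambda>(n, d). w (n, d) / supp I w d) d = supp I w d / supp I w d"
          by (subst (1 3) supp_def) (simp add: sum_divide_distrib)
        ultimately show ?thesis by simp
      qed
      then show ?thesis by simp
    qed
    also have "\<dots> = (\<Sum>n\<in>nbrs I Y. \<Sum>d\<in>cands_of I n \<inter> Y. w (n, d) / supp I w d)"
      using Y by (subst sum_supp) auto
    also have "\<dots> \<le> (\<Sum>n\<in>nbrs I Y. load A w n)"
      unfolding load_def using Y finite_cands_of feas supp_nonneg[OF feas]
      by (intro sum_mono sum_mono2 divide_nonneg_nonneg) (auto simp: feasible_def cands_of_def)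
    also have "\<dots> \<le> (\<Sum>n\<in>voters_of I c \<union> nbrs I Y. load A w n)"
      using load_nonneg[OF feas] finite_voters_of finite_nbrs by (intro sum_mono2) auto
    also have "\<dots> = (\<Sum>n\<in>voters_of I c. load A w n) + (\<Sum>n\<in>nbrs I Y - voters_of I c. load A w n)"
      using finite_voters_of finite_nbrs
      by (metis Diff_disjoint Un_Diff_cancel finite_Diff sum.union_disjoint)
    finally have "t * real (card Y) \<le> t * (\<Sum>n\<in>voters_of I c. load A w n)
        + (\<Sum>n\<in>nbrs I Y - voters_of I c. t * load A w n)"
      using t by (simp add: sum_distrib_left[symmetric] distrib_left[symmetric])
    also have "(\<Sum>n\<in>nbrs I Y - voters_of I c. t * load A w n) \<le> (\<Sum>n\<in>nbrs I Y - voters_of I c. strength I n)"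
      using load nbrs_sub by (intro sum_mono) auto
    finally have "t * real (card X) \<le> (\<Sum>n\<in>voters_of I c. strength I n) + (\<Sum>n\<in>nbrs I Y - voters_of I c. strength I n)"
      using num Y XY by (simp add: algebra_simps)
    also have "\<dots> = sum (strength I) (nbrs I X)"
      unfolding XY nbrs_insert using finite_voters_of finite_nbrs
      by (metis Diff_disjoint Un_Diff_cancel finite_Diff sum.union_disjoint)
    finally show ?thesis .
  qed
qed

text \<open>Suppose all scores are below \<open>t\<close>. A voter outside \<open>V\<close> approves
  only members of support above \<open>2 * t\<close>, so scaling to \<open>t\<close> frees at least
  half of its strength; hence each candidate in \<open>B - A\<close> has at most
  \<open>2 * t\<close> of strength outside \<open>V\<close>. The strength of \<open>V\<close> is at
  most \<open>2 * t * card L\<close>, because these voters spend everything on \<open>L\<close>. As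
  \<open>card L < card Y\<close> and |B - A| \<le> \<open>card Y\<close>, the neighbours of
  \<open>Y\<close> fall short of the \<open>4 * t\<close> per member that \<open>hB\<close>
  demands.\<close>

lemma exists_score_ge:
  assumes bal: "balanced I A w" and A: "A \<subseteq> cands I" "card A < seats I" and t: "0 < t"
    and hA: "hall I A t" and B: "B \<subseteq> cands I" "card B = seats I" and hB: "hall I B (4 * t)"
  shows "\<exists>c\<in>cands I - A. t \<le> score A w c"
proof (rule ccontr)
  assume contra: "\<not> ?thesis"
  have feas: "feasible I w" using bal by (rule balanced_feasible)
  have fin: "finite A" "finite B" using A B finite_cands finite_subset by blast+
  \<comment> \<open>With a cut-off of x t the two charges are x t per member of \<open>L\<close> and
    x t / (x - 1) per member of \<open>B - A\<close>. Their sum is least at x = 2, where it is 4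
    t.\<close>
  define L where "L = {c \<in> A. supp I w c \<le> 2 * t}"
  define V where "V = nbrs I L"
  have far: "sum (strength I) (voters_of I c - V) \<le> 2 * t" if c: "c \<in> B - A" for c
  proof -
    have "score A w c < t" using contra c B by force
    then have "(\<Sum>n\<in>voters_of I c. strength I n) < t * (1 + (\<Sum>n\<in>voters_of I c. load A w n))"
      using sum_load_nonneg[OF feas, of A c] unfolding score_def by (simp add: pos_divide_less_eq)
    then have 1: "(\<Sum>n\<in>voters_of I c. strength I n - t * load A w n) < t"
      by (simp add: sum_subtractf sum_distrib_left[symmetric] algebra_simps)
    have "(\<Sum>n\<in>voters_of I c - V. strength I n / 2) \<le> (\<Sum>n\<in>voters_of I c - V. strength I n - t * load A w n)"
    proof (intro sum_mono)
      fix n assume n: "n \<in> voters_of I c - V"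
      have "(2 * t) * load A w n \<le> strength I n"
        using n voters_of_sub t
        by (intro load_le[OF feas]) (force simp: V_def nbrs_def L_def cands_of_def voters_of_def)+
      then show "strength I n / 2 \<le> strength I n - t * load A w n" by simp
    qed
    also have "\<dots> \<le> (\<Sum>n\<in>voters_of I c. strength I n - t * load A w n)"
      using load_le[OF feas _ t, of _ A] balanced_supp_ge[OF bal A(1) hA] finite_voters_of voters_of_sub[of c]
      by (intro sum_mono2) auto
    finally show ?thesis using 1 by (simp add: sum_divide_distrib[symmetric])
  qed
  define Y where "Y = (B - A) \<union> (B \<inter> L)"
  have D: "card (A - B) < card (B - A)" using card_less_sym_Diff[OF fin] A B by simp
  have cY: "card Y = card (B - A) + card (B \<inter> L)"
    unfolding Y_def using fin by (intro card_Un_disjoint) (auto simp: L_def)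
  have "card L \<le> card (B \<inter> L) + card (L - B)"
    using card_Un_le[of "B \<inter> L" "L - B"] by (metis Int_Diff_Un Int_commute)
  moreover have "card (L - B) \<le> card (A - B)" using fin by (intro card_mono) (auto simp: L_def)
  ultimately have cL: "card L < card Y" using D cY by linarith
  have "4 * t * real (card Y) \<le> sum (strength I) (nbrs I Y)"
    using hallD[OF hB, of Y] by (auto simp: Y_def)
  also have "\<dots> \<le> sum (strength I) (V \<union> (\<Union>c\<in>B - A. voters_of I c - V))"
    unfolding V_def using nbrs_sub voters_of_sub
    by (intro sum_strength_mono) (auto simp: nbrs_def Y_def)
  also have "\<dots> \<le> sum (strength I) V + sum (strength I) (\<Union>c\<in>B - A. voters_of I c - V)"
    using finite_nbrs finite_voters_of fin strength_nonneg voters_of_sub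
    by (subst sum.union_disjoint) (auto simp: V_def)
  also have "sum (strength I) (\<Union>c\<in>B - A. voters_of I c - V) \<le> (\<Sum>c\<in>B - A. sum (strength I) (voters_of I c - V))"
    using fin strength_nonneg voters_of_sub finite_voters_of
    by (intro sum_UN_le) auto
  also have "\<dots> \<le> (\<Sum>c\<in>B - A. 2 * t)" using far by (intro sum_mono) auto
  also have "sum (strength I) V \<le> (\<Sum>c\<in>L. 2 * t)"
    unfolding V_def L_def strength_of_low_nbrs[OF bal A(1)] by (intro sum_mono) auto
  finally have "2 * t * (2 * real (card Y)) \<le> 2 * t * (real (card L) + real (card (B - A)))"
    by (simp add: algebra_simps)
  then have "2 * card Y \<le> card L + card (B - A)" using t by (simp flip: of_nat_add of_nat_mult)
  then show False using cL cY by linarith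
qed

section \<open>The optimum in terms of Hall thresholds\<close>

lemma hall_min_supp:
  assumes "full_solution I A w"
  shows "hall I A (min_supp I w A)"
proof (rule hall_if_supp_ge)
  show "feasible I w" "A \<subseteq> cands I" using assms by (auto simp: full_solution_def)
  fix c assume "c \<in> A"
  then show "min_supp I w A \<le> supp I w c"
    using finite_subset[OF \<open>A \<subseteq> cands I\<close> finite_cands] by (simp add: min_supp_def)
qed

text \<open>The competitors of the search are sets with a Hall threshold, and this transfers a bound
  on all of them to the supremum \<open>opt\<close>. The given solution makes the set of values
  nonempty.\<close>

lemma opt_le:
  assumes "full_solution I A w"
    and "\<And>B v. B \<subseteq> cands I \<Longrightarrow> card B = seats I \<Longrightarrow> hall I B v \<Longrightarrow> v \<le> b"
  shows "opt I \<le> b"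
  unfolding opt_def
proof (rule cSup_least)
  show "{min_supp I w A |A w. full_solution I A w} \<noteq> {}" using assms(1) by blast
  fix v assume "v \<in> {min_supp I w A |A w. full_solution I A w}"
  then obtain B u where "v = min_supp I u B" and B: "full_solution I B u" by blast
  then show "v \<le> b" using hall_min_supp[OF B] assms(2)[of B v] by (simp add: full_solution_def)
qed

end

section \<open>Total correctness with a time bound\<close>

type_synonym subroutine = "(nat \<Rightarrow> nat) \<Rightarrow> (nat \<Rightarrow> real) \<times> nat"

text \<open>As \<open>exec\<close> is deterministic, this speaks of the only possible run. The bound
  is a real number and need not be exact, so costs can be rounded up to multiples of
  \<open>bal\<close> on the way.\<close>

definition run :: "subroutine \<Rightarrow> prog \<Rightarrow> store \<Rightarrow> real \<Rightarrow> (store \<Rightarrow> bool) \<Rightarrow> bool" where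
  "run f p s b Q \<longleftrightarrow> (\<exists>t s'. exec f p s t s' \<and> real t \<le> b \<and> Q s')"

text \<open>A syntactic footprint by whole arrays. The frame facts that it supplies in
  \<open>run_Seq\<close> and \<open>run_For\<close> spare the assertions a list of everything that
  stays unchanged.\<close>

fun nwrites :: "prog \<Rightarrow> name \<Rightarrow> bool" where
  "nwrites (NSet x i a) y \<longleftrightarrow> y = x"
| "nwrites (Seq p q) y \<longleftrightarrow> nwrites p y \<or> nwrites q y"
| "nwrites (Cond b p q) y \<longleftrightarrow> nwrites p y \<or> nwrites q y"
| "nwrites (While b p) y \<longleftrightarrow> nwrites p y"
| "nwrites _ y \<longleftrightarrow> False"

fun rwrites :: "prog \<Rightarrow> name \<Rightarrow> bool" where
  "rwrites (RSet x i a) y \<longleftrightarrow> y = x"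
| "rwrites (Call x z) y \<longleftrightarrow> y = z"
| "rwrites (Seq p q) y \<longleftrightarrow> rwrites p y \<or> rwrites q y"
| "rwrites (Cond b p q) y \<longleftrightarrow> rwrites p y \<or> rwrites q y"
| "rwrites (While b p) y \<longleftrightarrow> rwrites p y"
| "rwrites _ y \<longleftrightarrow> False"

lemma store_upd_simps [simp]:
  "nats (nupd x i v s) y = (if y = x then (nats s x)(i := v) else nats s y)"
  "reals (nupd x i v s) = reals s"
  "reals (rupd x i r s) y = (if y = x then (reals s x)(i := r) else reals s y)"
  "nats (rupd x i r s) = nats s"
  by (auto simp: nupd_def rupd_def)

definition nframe :: "prog \<Rightarrow> store \<Rightarrow> store \<Rightarrow> bool" where
  "nframe p s s' \<longleftrightarrow> (\<forall>y. \<not> nwrites p y \<longrightarrow> nats s' y = nats s y)"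

definition rframe :: "prog \<Rightarrow> store \<Rightarrow> store \<Rightarrow> bool" where
  "rframe p s s' \<longleftrightarrow> (\<forall>y. \<not> rwrites p y \<longrightarrow> reals s' y = reals s y)"

lemma nframeD: "nframe p s s' \<Longrightarrow> \<not> nwrites p y \<Longrightarrow> nats s' y = nats s y"
  and rframeD: "rframe p s s' \<Longrightarrow> \<not> rwrites p y \<Longrightarrow> reals s' y = reals s y"
  by (auto simp: nframe_def rframe_def)

lemma exec_frame: "exec f p s t s' \<Longrightarrow> nframe p s s' \<and> rframe p s s'"
  by (induction rule: exec.induct) (auto simp: nframe_def rframe_def)

lemma run_frame: "run f p s b Q \<Longrightarrow> run f p s b (\<lambda>s'. Q s' \<and> nframe p s s' \<and> rframe p s s')"
  unfolding run_def using exec_frame by blast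

lemma run_mono:
  assumes "run f p s b Q" "b \<le> b'"
    and "\<And>s'. Q s' \<Longrightarrow> nframe p s s' \<Longrightarrow> rframe p s s' \<Longrightarrow> Q' s'"
  shows "run f p s b' Q'"
  using assms(1)[THEN run_frame] assms(2,3) unfolding run_def by (meson order_trans)

lemma run_Skip: "Q s \<Longrightarrow> 1 \<le> b \<Longrightarrow> run f Skip s b Q"
  unfolding run_def using exec.Skip by fastforce

lemma run_NSet: "Q (nupd x (nval i s) (nval a s) s) \<Longrightarrow> 1 \<le> b \<Longrightarrow> run f (NSet x i a) s b Q"
  unfolding run_def using exec.NSet by (metis of_nat_1)

lemma run_RSet: "Q (rupd x (nval i s) (rval a s) s) \<Longrightarrow> 1 \<le> b \<Longrightarrow> run f (RSet x i a) s b Q"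
  unfolding run_def using exec.RSet by (metis of_nat_1)

lemma run_Call:
  "Q (s\<lparr>reals := (reals s)(y := fst (f (nats s x)))\<rparr>) \<Longrightarrow> real (snd (f (nats s x))) \<le> b
    \<Longrightarrow> run f (Call x y) s b Q"
  unfolding run_def using exec.Call[of f s x "fst (f (nats s x))" "snd (f (nats s x))" y] by fastforce

lemma run_Seq:
  assumes "run f p s b P" "b + c \<le> d"
    and "\<And>s'. P s' \<Longrightarrow> nframe p s s' \<Longrightarrow> rframe p s s' \<Longrightarrow> run f q s' c Q"
  shows "run f (Seq p q) s d Q"
proof -
  from run_frame[OF assms(1)] obtain t s' where 1: "exec f p s t s'" "real t \<le> b"
    and "P s'" "nframe p s s'" "rframe p s s'"
    unfolding run_def by blast
  then obtain u s'' where "exec f q s' u s''" "real u \<le> c" "Q s''"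
    using assms(3) unfolding run_def by blast
  then show ?thesis
    using exec.Seq[OF 1(1)] 1(2) assms(2) unfolding run_def by (intro exI[of _ "t + u"] exI[of _ s'']) auto
qed

lemma run_Cond:
  assumes "bval c s \<Longrightarrow> run f p s b Q" "\<not> bval c s \<Longrightarrow> run f q s b Q" "1 + b \<le> d"
  shows "run f (Cond c p q) s d Q"
proof (cases "bval c s")
  case True
  then obtain t s' where "exec f p s t s'" "real t \<le> b" "Q s'" using assms(1) unfolding run_def by blast
  then show ?thesis using exec.CondT[of c s f p t s' q] True assms(3)
    unfolding run_def by (intro exI[of _ "1 + t"] exI[of _ s']) auto
next
  case False
  then obtain t s' where "exec f q s t s'" "real t \<le> b" "Q s'" using assms(2) unfolding run_def by blast
  then show ?thesis using exec.CondF[of c s f q t s' p] False assms(3)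
    unfolding run_def by (intro exI[of _ "1 + t"] exI[of _ s']) auto
qed

text \<open>The index of \<open>Inv\<close> bounds the iterations that are left, and at 0 the test
  must fail. An iteration is charged \<open>b\<close> and one test; the leading 1 is the last
  test.\<close>

lemma run_While:
  assumes step: "\<And>n s. Inv n s \<Longrightarrow> bval c s \<Longrightarrow> 0 < n \<and> run f p s b (Inv (n - 1))"
    and b: "0 \<le> b" and init: "Inv n s"
  shows "run f (While c p) s (1 + real n * (b + 1)) (\<lambda>s'. \<not> bval c s' \<and> (\<exists>m. Inv m s'))"
  using init
proof (induction n arbitrary: s)
  case 0
  then have "\<not> bval c s" using step by blast
  then show ?case using exec.WhileF[of c s f p] 0
    unfolding run_def by (intro exI[of _ 1] exI[of _ s]) auto
next
  case (Suc n)
  show ?case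
  proof (cases "bval c s")
    case True
    then obtain t s' where 1: "exec f p s t s'" "real t \<le> b" "Inv n s'"
      using step[OF Suc.prems] unfolding run_def by auto
    then obtain u s'' where 2: "exec f (While c p) s' u s''" "real u \<le> 1 + real n * (b + 1)"
      "\<not> bval c s''" "\<exists>m. Inv m s''"
      using Suc.IH unfolding run_def by blast
    then show ?thesis using exec.WhileT[OF True 1(1) 2(1)] 1(2)
      unfolding run_def by (intro exI[of _ "1 + t + u"] exI[of _ s'']) (auto simp: algebra_simps)
  next
    case False
    then show ?thesis using exec.WhileF[of c s f p] Suc.prems b
      unfolding run_def by (intro exI[of _ 1] exI[of _ s]) auto
  qed
qed

section \<open>Counting loops over arrays\<close>

definition For :: "name \<Rightarrow> name \<Rightarrow> prog \<Rightarrow> prog" where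
  "For x n p = Seq (NSet x (NConst 0) (NConst 0))
     (While (NLess (NGet x (NConst 0)) (NGet n (NConst 0)))
       (Seq p (NSet x (NConst 0) (NAdd (NGet x (NConst 0)) (NConst 1)))))"

lemma writes_For [simp]:
  "nwrites (For x n p) y \<longleftrightarrow> y = x \<or> nwrites p y"
  "rwrites (For x n p) y \<longleftrightarrow> rwrites p y"
  by (auto simp: For_def)

text \<open>Increment and test add 2 to each iteration, initialisation and last test another 2. The
  frame facts in \<open>step\<close> go back to the start of the whole loop, so what is known about
  \<open>s\<close> is available in every iteration.\<close>

lemma run_For:
  assumes names: "x \<noteq> n" "\<not> nwrites p x" "\<not> nwrites p n" and b: "0 \<le> b"
    and init: "Inv 0 (nupd x 0 0 s)"
    and step: "\<And>i s'. i < nats s n 0 \<Longrightarrow> Inv i s' \<Longrightarrow> nats s' x 0 = i \<Longrightarrow>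
      nframe (For x n p) s s' \<Longrightarrow> rframe (For x n p) s s' \<Longrightarrow>
      run f p s' b (\<lambda>s''. Inv (Suc i) (nupd x 0 (Suc i) s''))"
    and post: "\<And>s'. Inv (nats s n 0) s' \<Longrightarrow> Q s'"
    and d: "2 + real (nats s n 0) * (b + 2) \<le> d"
  shows "run f (For x n p) s d Q"
proof -
  define N where "N = nats s n 0"
  \<comment> \<open>\<open>run_While\<close> counts down and the loop variable counts up;
    \<open>k + i = N\<close> links the two.\<close>
  define Inv' where "Inv' = (\<lambda>k s'. \<exists>i. k + i = N \<and> nats s' x 0 = i \<and> Inv i s' \<and>
    nframe (For x n p) s s' \<and> rframe (For x n p) s s')"
  let ?c = "NLess (NGet x (NConst 0)) (NGet n (NConst 0))"
  let ?p = "Seq p (NSet x (NConst 0) (NAdd (NGet x (NConst 0)) (NConst 1)))"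
  have N: "nats s' n 0 = N" if "nframe (For x n p) s s'" for s'
    using nframeD[OF that, of n] names by (simp add: N_def)
  have loop: "run f (While ?c ?p) (nupd x 0 0 s) (1 + real N * ((b + 1) + 1))
      (\<lambda>s'. \<not> bval ?c s' \<and> (\<exists>k. Inv' k s'))"
  proof (rule run_While)
    fix k s' assume "Inv' k s'" and c: "bval ?c s'"
    then obtain i where i: "k + i = N" "nats s' x 0 = i" "Inv i s'"
      and fr: "nframe (For x n p) s s'" "rframe (For x n p) s s'"
      unfolding Inv'_def by blast
    have "i < N" using c i N[OF fr(1)] by simp
    have "run f ?p s' (b + 1) (Inv' (k - 1))"
    proof (rule run_Seq)
      show "run f p s' b (\<lambda>s''. Inv (Suc i) (nupd x 0 (Suc i) s''))"
        using step[of i s'] \<open>i < N\<close> i fr by (simp add: N_def)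
      fix s'' assume inv: "Inv (Suc i) (nupd x 0 (Suc i) s'')"
        and fr': "nframe p s' s''" "rframe p s' s''"
      have "nats s'' x 0 = i" using nframeD[OF fr'(1), of x] names i by simp
      moreover have "nframe (For x n p) s (nupd x 0 (Suc i) s'')"
        using fr(1) fr'(1) unfolding nframe_def by auto
      moreover have "rframe (For x n p) s (nupd x 0 (Suc i) s'')"
        using fr(2) fr'(2) unfolding rframe_def by auto
      ultimately show "run f (NSet x (NConst 0) (NAdd (NGet x (NConst 0)) (NConst 1))) s'' 1 (Inv' (k - 1))"
        using inv i \<open>i < N\<close> unfolding Inv'_def by (intro run_NSet) (auto intro!: exI[of _ "Suc i"])
    qed simp
    then show "0 < k \<and> run f ?p s' (b + 1) (Inv' (k - 1))" using i \<open>i < N\<close> by simp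
  next
    show "Inv' N (nupd x 0 0 s)"
      using init unfolding Inv'_def by (auto simp: nframe_def rframe_def)
  qed (use b in simp)
  have "run f (While ?c ?p) (nupd x 0 0 s) (1 + real N * (b + 2)) Q"
  proof (rule run_mono[OF loop])
    fix s' assume "\<not> bval ?c s' \<and> (\<exists>k. Inv' k s')"
    then obtain i k where "k + i = N" "nats s' x 0 = i" "Inv i s'" "\<not> i < N"
      unfolding Inv'_def using N by auto
    then have "Inv N s'" by auto
    then show "Q s'" using post by (simp add: N_def)
  qed (simp add: algebra_simps)
  then show ?thesis
    unfolding For_def using d
    by (intro run_Seq[where b = 1 and P = "\<lambda>s'. s' = nupd x 0 0 s", OF run_NSet])
      (auto simp: N_def)
qed

abbreviation J :: nexp where "J \<equiv> NGet ''j'' (NConst 0)"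

definition nfill :: "name \<Rightarrow> name \<Rightarrow> nexp \<Rightarrow> prog" where
  "nfill n x e = For ''j'' n (NSet x J e)"

definition rfill :: "name \<Rightarrow> name \<Rightarrow> rexp \<Rightarrow> prog" where
  "rfill n x e = For ''j'' n (RSet x J e)"

text \<open>A scatter-add: with a constant index it sums into a scalar, and with an end point of
  edge \<open>j\<close> as index it computes the sums over incident edges for all vertices in one
  pass.\<close>

definition accum :: "name \<Rightarrow> name \<Rightarrow> nexp \<Rightarrow> rexp \<Rightarrow> prog" where
  "accum n x i e = For ''j'' n (RSet x i (RAdd (RGet x i) e))"

lemma writes_fill [simp]:
  "nwrites (nfill n x e) y \<longleftrightarrow> y = ''j'' \<or> y = x" "rwrites (nfill n x e) y \<longleftrightarrow> False"
  "nwrites (rfill n x a) y \<longleftrightarrow> y = ''j''" "rwrites (rfill n x a) y \<longleftrightarrow> y = x"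
  "nwrites (accum n x i a) y \<longleftrightarrow> y = ''j''" "rwrites (accum n x i a) y \<longleftrightarrow> y = x"
  by (auto simp: nfill_def rfill_def accum_def)

lemma run_nfill:
  assumes "n \<noteq> ''j''" "x \<noteq> ''j''" "x \<noteq> n" "2 + 3 * real (nats s n 0) \<le> d"
    and val: "\<And>j s'. j < nats s n 0 \<Longrightarrow> nats s' ''j'' 0 = j \<Longrightarrow>
      nframe (nfill n x e) s s' \<Longrightarrow> rframe (nfill n x e) s s' \<Longrightarrow> nval e s' = v j"
  shows "run f (nfill n x e) s d (\<lambda>s'. \<forall>i<nats s n 0. nats s' x i = v i)"
  unfolding nfill_def
proof (rule run_For[where b = 1 and Inv = "\<lambda>j s'. \<forall>i<j. nats s' x i = v i"])
  fix i s'
  assume "i < nats s n 0" "\<forall>k<i. nats s' x k = v k" "nats s' ''j'' 0 = i"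
    "nframe (For ''j'' n (NSet x J e)) s s'" "rframe (For ''j'' n (NSet x J e)) s s'"
  with val[of i s'] show "run f (NSet x J e) s' 1 (\<lambda>s''. \<forall>k<Suc i. nats (nupd ''j'' 0 (Suc i) s'') x k = v k)"
    using assms(2) by (intro run_NSet) (auto simp: nfill_def less_Suc_eq)
qed (use assms(1-4) in auto)

lemma run_rfill:
  assumes "n \<noteq> ''j''" "2 + 3 * real (nats s n 0) \<le> d"
    and val: "\<And>j s'. j < nats s n 0 \<Longrightarrow> nats s' ''j'' 0 = j \<Longrightarrow>
      nframe (rfill n x e) s s' \<Longrightarrow> rframe (rfill n x e) s s' \<Longrightarrow> rval e s' = v j"
  shows "run f (rfill n x e) s d (\<lambda>s'. \<forall>i<nats s n 0. reals s' x i = v i)"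
  unfolding rfill_def
proof (rule run_For[where b = 1 and Inv = "\<lambda>j s'. \<forall>i<j. reals s' x i = v i"])
  fix i s'
  assume "i < nats s n 0" "\<forall>k<i. reals s' x k = v k" "nats s' ''j'' 0 = i"
    "nframe (For ''j'' n (RSet x J e)) s s'" "rframe (For ''j'' n (RSet x J e)) s s'"
  with val[of i s'] show "run f (RSet x J e) s' 1 (\<lambda>s''. \<forall>k<Suc i. reals (nupd ''j'' 0 (Suc i) s'') x k = v k)"
    by (intro run_RSet) (auto simp: rfill_def less_Suc_eq)
qed (use assms(1,2) in auto)

lemma run_accum:
  assumes "n \<noteq> ''j''" "2 + 3 * real (nats s n 0) \<le> d"
    and val: "\<And>j s'. j < nats s n 0 \<Longrightarrow> nats s' ''j'' 0 = j \<Longrightarrow>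
      nframe (accum n x a e) s s' \<Longrightarrow> rframe (accum n x a e) s s' \<Longrightarrow> nval a s' = h j \<and> rval e s' = v j"
  shows "run f (accum n x a e) s d (\<lambda>s'. \<forall>i. reals s' x i =
    reals s x i + (\<Sum>j | j < nats s n 0 \<and> h j = i. v j))"
  unfolding accum_def
proof (rule run_For[where b = 1 and Inv = "\<lambda>m s'. \<forall>i. reals s' x i =
    reals s x i + (\<Sum>j | j < m \<and> h j = i. v j)"])
  let ?p = "RSet x a (RAdd (RGet x a) e)"
  fix m s'
  assume *: "m < nats s n 0" "\<forall>i. reals s' x i = reals s x i + (\<Sum>j | j < m \<and> h j = i. v j)"
    "nats s' ''j'' 0 = m" "nframe (For ''j'' n ?p) s s'" "rframe (For ''j'' n ?p) s s'"
  then have v: "nval a s' = h m" "rval e s' = v m" using val[of m s'] by (auto simp: accum_def)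
  have "(\<Sum>j | j < Suc m \<and> h j = i. v j) = (\<Sum>j | j < m \<and> h j = i. v j) + (if h m = i then v m else 0)" for i
  proof -
    have "{j. j < Suc m \<and> h j = i} = (if h m = i then insert m else id) {j. j < m \<and> h j = i}"
      by (auto simp: less_Suc_eq)
    then show ?thesis by (auto simp: add.commute)
  qed
  then show "run f ?p s' 1 (\<lambda>s''. \<forall>i. reals (nupd ''j'' 0 (Suc m) s'') x i =
      reals s x i + (\<Sum>j | j < Suc m \<and> h j = i. v j))"
    using * v by (intro run_RSet) auto
qed (use assms(1,2) in auto)

section \<open>The algorithm\<close>

abbreviation nvar :: "name \<Rightarrow> nexp" where "nvar x \<equiv> NGet x (NConst 0)"
abbreviation rvar :: "name \<Rightarrow> rexp" where "rvar x \<equiv> RGet x (NConst 0)"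
abbreviation nset :: "name \<Rightarrow> nexp \<Rightarrow> prog" where "nset x a \<equiv> NSet x (NConst 0) a"
abbreviation rset :: "name \<Rightarrow> rexp \<Rightarrow> prog" where "rset x a \<equiv> RSet x (NConst 0) a"
abbreviation rnum :: "nat \<Rightarrow> rexp" where "rnum m \<equiv> RNat (NConst m)"

text \<open>
  The arrays \<open>cur\<close>, \<open>base\<close> and \<open>committee\<close> are indicators of the committee under construction, of the
  set from which all scans start, and of the best committee so far; \<open>cnt\<close> and \<open>bcnt\<close> are the sizes of
  the first two. The bisection maintains that \<open>committee\<close> has value at least \<open>lo\<close> and that the optimum is
  at most \<open>2 * up\<close>.
\<close>

definition supports :: prog where
  "supports = Seq (rfill ''numcands'' ''sup'' (rnum 0))
     (accum ''numedges'' ''sup'' (NGet ''cand'' J) (RGet ''w'' J))"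

text \<open>Initialising with \<open>thr\<close> stands in for an infinite value. In a scan only the
  test \<open>mn < thr\<close> matters, and in \<open>start\<close> the cap is the quota, which no
  committee of full size can exceed.\<close>

definition minimum :: prog where
  "minimum = Seq (rset ''mn'' (rvar ''thr''))
     (For ''j'' ''numcands'' (Cond (BAnd (NLess (NConst 0) (NGet ''cur'' J)) (RLess (RGet ''sup'' J) (rvar ''mn'')))
        (rset ''mn'' (RGet ''sup'' J)) Skip))"

definition evaluate :: prog where
  "evaluate = Seq (Call ''cur'' ''w'') (Seq supports minimum)"

text \<open>The guard on \<open>cnt\<close> also keeps every call within \<open>seats\<close>
  members, the range in which \<open>balancing_procedure\<close> promises anything. After the last
  seat is filled the remaining rounds are idle.\<close>

definition scan :: prog where
  "scan = For ''i'' ''numcands''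
     (Cond (BAnd (NLess (nvar ''cnt'') (nvar ''seats'')) (BNot (NLess (NConst 0) (NGet ''cur'' (nvar ''i'')))))
       (Seq (NSet ''cur'' (nvar ''i'') (NConst 1))
         (Seq evaluate
           (Cond (RLess (rvar ''mn'') (rvar ''thr''))
             (NSet ''cur'' (nvar ''i'') (NConst 0))
             (nset ''cnt'' (NAdd (nvar ''cnt'') (NConst 1))))))
       Skip)"

text \<open>The factor \<open>x / x\<close> is the indicator of \<open>x \<noteq> 0\<close>.\<close>

definition loads :: prog where
  "loads = Seq (rfill ''numvoters'' ''load'' (rnum 0))
     (accum ''numedges'' ''load'' (NGet ''voter'' J)
       (RMul (RDiv (RNat (NGet ''cur'' (NGet ''cand'' J))) (RNat (NGet ''cur'' (NGet ''cand'' J))))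
          (RDiv (RGet ''w'' J) (RGet ''sup'' (NGet ''cand'' J)))))"

definition scores :: prog where
  "scores = Seq
     (Seq (rfill ''numcands'' ''num'' (rnum 0))
        (accum ''numedges'' ''num'' (NGet ''cand'' J) (RGet ''strength'' (NGet ''voter'' J))))
     (Seq (rfill ''numcands'' ''den'' (rnum 1))
        (accum ''numedges'' ''den'' (NGet ''cand'' J) (RGet ''load'' (NGet ''voter'' J))))"

text \<open>The comparison is "not less" because all outsiders may have score 0 and
  \<open>best\<close> holds an arbitrary number at first: a tie with the initial 0 must already
  record a candidate.\<close>

definition pick :: prog where
  "pick = Seq (rset ''bs'' (rnum 0))
     (For ''j'' ''numcands''
       (Cond (BAnd (BNot (NLess (NConst 0) (NGet ''cur'' J)))
                (BNot (RLess (RDiv (RGet ''num'' J) (RGet ''den'' J)) (rvar ''bs''))))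
         (Seq (nset ''best'' J) (rset ''bs'' (RDiv (RGet ''num'' J) (RGet ''den'' J)))) Skip))"

text \<open>A round adds one member until the seats are filled, and there are fewer seats than
  candidates, so this many rounds suffice.\<close>

definition greedy :: prog where
  "greedy = For ''i'' ''numcands''
     (Cond (NLess (nvar ''cnt'') (nvar ''seats''))
       (Seq (Call ''cur'' ''w'') (Seq supports (Seq loads (Seq scores (Seq pick
         (Seq (NSet ''cur'' (nvar ''best'') (NConst 1)) (nset ''cnt'' (NAdd (nvar ''cnt'') (NConst 1)))))))))
       Skip)"

definition setup_quota :: prog where
  "setup_quota =
     Seq (rset ''tot'' (rnum 0))
    (Seq (accum ''numvoters'' ''tot'' (NConst 0) (RGet ''strength'' J))
    (Seq (rset ''thr'' (RDiv (rvar ''tot'') (RNat (nvar ''seats''))))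
    (Seq (nfill ''numcands'' ''cur'' (NConst 0))
         (nset ''cnt'' (NConst 0)))))"

definition seed :: prog where
  "seed = Seq scan (Seq (nfill ''numcands'' ''base'' (NGet ''cur'' J)) (nset ''bcnt'' (nvar ''cnt'')))"

text \<open>Here \<open>thr\<close> still holds the quota, so \<open>up\<close> becomes the minimum
  of \<open>2 * lo\<close> and the quota. The first value bounds the initial ratio of
  \<open>up\<close> to \<open>lo\<close>, the second keeps all later thresholds within reach of
  \<open>base\<close>.\<close>

definition start :: prog where
  "start =
     Seq greedy
    (Seq evaluate
    (Seq (rset ''lo'' (rvar ''mn''))
    (Seq (Cond (RLess (RMul (rnum 2) (rvar ''lo'')) (rvar ''thr''))
           (rset ''up'' (RMul (rnum 2) (rvar ''lo''))) (rset ''up'' (rvar ''thr'')))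
         (nfill ''numcands'' ''committee'' (NGet ''cur'' J)))))"

definition bisect :: prog where
  "bisect =
     Seq (rset ''thr'' (RDiv (RAdd (rvar ''lo'') (rvar ''up'')) (rnum 2)))
    (Seq (nfill ''numcands'' ''cur'' (NGet ''base'' J))
    (Seq (nset ''cnt'' (nvar ''bcnt''))
    (Seq scan
      (Cond (NLess (nvar ''cnt'') (nvar ''seats''))
        (rset ''up'' (rvar ''thr''))
        (Seq (rset ''lo'' (rvar ''thr'')) (nfill ''numcands'' ''committee'' (NGet ''cur'' J)))))))"

text \<open>On exit the optimum is at most 2 \<open>up\<close> \<le> (2 + \<epsilon>)
  \<open>lo\<close>. The form without division also covers \<open>lo = 0\<close>: then
  \<open>up\<close> is 0 after \<open>start\<close>, and the loop is not entered.\<close>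

definition unfinished :: bexp where
  "unfinished = RLess (RMul (rvar ''lo'') (RAdd (rnum 2) (rvar ''eps''))) (RMul (rnum 2) (rvar ''up''))"

text \<open>The search stores only the committee; the last call recovers a balanced vector for it,
  whose supports reach \<open>lo\<close>.\<close>

definition lazy_mms :: prog where
  "lazy_mms = Seq setup_quota (Seq seed (Seq start (Seq (While unfinished bisect) (Call ''committee'' ''weight''))))"

lemma writes_blocks [simp]:
  "nwrites supports y \<longleftrightarrow> y = ''j''" "rwrites supports y \<longleftrightarrow> y = ''sup''"
  "nwrites minimum y \<longleftrightarrow> y = ''j''" "rwrites minimum y \<longleftrightarrow> y = ''mn''"
  "nwrites evaluate y \<longleftrightarrow> y = ''j''" "rwrites evaluate y \<longleftrightarrow> y \<in> {''w'', ''sup'', ''mn''}"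
  "nwrites loads y \<longleftrightarrow> y = ''j''" "rwrites loads y \<longleftrightarrow> y = ''load''"
  "nwrites scores y \<longleftrightarrow> y = ''j''" "rwrites scores y \<longleftrightarrow> y \<in> {''num'', ''den''}"
  "nwrites pick y \<longleftrightarrow> y \<in> {''j'', ''best''}" "rwrites pick y \<longleftrightarrow> y = ''bs''"
  "nwrites scan y \<longleftrightarrow> y \<in> {''i'', ''j'', ''cur'', ''cnt''}" "rwrites scan y \<longleftrightarrow> y \<in> {''w'', ''sup'', ''mn''}"
  "nwrites greedy y \<longleftrightarrow> y \<in> {''i'', ''j'', ''cur'', ''cnt'', ''best''}"
  "rwrites greedy y \<longleftrightarrow> y \<in> {''w'', ''sup'', ''load'', ''num'', ''den'', ''bs''}"
  by (auto simp: supports_def minimum_def evaluate_def loads_def scores_def pick_def scan_def greedy_def)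

lemma decode_iff:
  "distinct cs \<Longrightarrow> i < length cs \<Longrightarrow> cs ! i \<in> decode_cands cs a \<longleftrightarrow> a i \<noteq> 0"
  unfolding decode_cands_def by (auto simp: nth_eq_iff_index_eq)

lemma decode_sub: "decode_cands cs a \<subseteq> set cs"
  unfolding decode_cands_def by auto

lemma decode_upd:
  "i < length cs \<Longrightarrow> v \<noteq> 0 \<Longrightarrow> decode_cands cs (a(i := v)) = insert (cs ! i) (decode_cands cs a)"
  unfolding decode_cands_def by auto

lemma decode_cong:
  "(\<And>i. i < length cs \<Longrightarrow> a i = b i) \<Longrightarrow> decode_cands cs a = decode_cands cs b"
  unfolding decode_cands_def by auto

section \<open>The instance in memory\<close>

locale machine = instance_of_election I for I :: "('v, 'c) election" +
  fixes vs :: "'v list" and cs :: "'c list" and es :: "('v \<times> 'c) list" and \<epsilon> :: real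
    and solve :: "'c set \<Rightarrow> 'v \<times> 'c \<Rightarrow> real" and time :: "'c set \<Rightarrow> nat" and bal :: real
  assumes enum: "enumerates I vs cs es" and eps: "0 < \<epsilon>"
    and procedure: "balancing_procedure I solve time bal"
begin

abbreviation f :: subroutine where "f \<equiv> subroutine cs es solve time"
abbreviation inp :: "store \<Rightarrow> bool" where "inp \<equiv> input_store I vs cs es \<epsilon>"
abbreviation comm :: "store \<Rightarrow> 'c set" where "comm s \<equiv> decode_cands cs (nats s ''cur'')"

lemma distinct_cs: "distinct cs" and set_cs: "set cs = cands I"
  and distinct_vs: "distinct vs" and set_vs: "set vs = voters I"
  and distinct_es: "distinct es" and set_es: "set es = edges I"
  using enum unfolding enumerates_def by auto

lemma length_cs: "length cs = card (cands I)" and length_vs: "length vs = card (voters I)"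
  and length_es: "length es = card (edges I)"
  using distinct_cs set_cs distinct_vs set_vs distinct_es set_es distinct_card by metis+

lemma solve_balanced: "A \<subseteq> cands I \<Longrightarrow> card A \<le> seats I \<Longrightarrow> balanced I A (solve A)"
  and time_le: "A \<subseteq> cands I \<Longrightarrow> card A \<le> seats I \<Longrightarrow> real (time A + length es) \<le> bal"
  using procedure unfolding balancing_procedure_def length_es by auto

lemma es_le: "real (length es) \<le> bal"
  using time_le[of "{}"] by simp

lemma cs_le: "real (length cs) \<le> bal" and vs_le: "real (length vs) \<le> bal"
  using es_le card_cands_le_edges card_voters_le_edges unfolding length_cs length_vs length_es by simp_all

lemma cs_ge: "1 \<le> real (length cs)"
  using seats_less unfolding length_cs by simp

lemma bal_ge: "1 \<le> bal"
  using cs_ge cs_le by simp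

lemma inpD:
  assumes "inp s"
  shows "nats s ''numvoters'' 0 = length vs" "nats s ''numcands'' 0 = length cs"
    "nats s ''numedges'' 0 = length es" "nats s ''seats'' 0 = seats I"
    "reals s ''eps'' 0 = \<epsilon>"
    "\<And>i. i < length vs \<Longrightarrow> reals s ''strength'' i = strength I (vs ! i)"
    "\<And>j. j < length es \<Longrightarrow> nats s ''voter'' j < length vs"
    "\<And>j. j < length es \<Longrightarrow> nats s ''cand'' j < length cs"
    "\<And>j. j < length es \<Longrightarrow> es ! j = (vs ! nats s ''voter'' j, cs ! nats s ''cand'' j)"
  using assms unfolding input_store_def by auto

lemma inp_cong:
  assumes "inp s" "\<And>y. y \<in> {''numvoters'', ''numcands'', ''numedges'', ''seats'', ''voter'', ''cand''} \<Longrightarrow> nats s' y = nats s y"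
    "\<And>y. y \<in> {''strength'', ''eps''} \<Longrightarrow> reals s' y = reals s y"
  shows "inp s'"
  using assms(1) unfolding input_store_def by (simp add: assms(2,3))

lemma inp_frame:
  assumes "inp s" "nframe p s s'" "rframe p s s'"
    "\<And>y. y \<in> {''numvoters'', ''numcands'', ''numedges'', ''seats'', ''voter'', ''cand''} \<Longrightarrow> \<not> nwrites p y"
    "\<And>y. y \<in> {''strength'', ''eps''} \<Longrightarrow> \<not> rwrites p y"
  shows "inp s'"
  using assms by (intro inp_cong[OF assms(1)]) (blast intro: nframeD rframeD)+

text \<open>The edge list is free of duplicates, so the positions with candidate number
  \<open>i\<close> correspond one to one to the approvers of \<open>cs ! i\<close>. This reads the
  sums made by \<open>accum\<close> as sums over the graph.\<close>

lemma edge_sum_cand: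
  assumes "inp s" "i < length cs"
  shows "(\<Sum>j | j < length es \<and> nats s ''cand'' j = i. g (es ! j)) = (\<Sum>n\<in>voters_of I (cs ! i). g (n, cs ! i))"
proof (rule sum.reindex_cong[symmetric])
  let ?S = "{j. j < length es \<and> nats s ''cand'' j = i}"
  have es: "snd (es ! j) = cs ! i" if "j \<in> ?S" for j
    using that inpD(9)[OF assms(1), of j] by auto
  show "inj_on (\<lambda>j. fst (es ! j)) ?S"
  proof (rule inj_onI)
    fix j k assume jk: "j \<in> ?S" "k \<in> ?S" "fst (es ! j) = fst (es ! k)"
    then have "es ! j = es ! k" using es[of j] es[of k] by (simp add: prod_eq_iff)
    then show "j = k" using jk distinct_es by (simp add: nth_eq_iff_index_eq)
  qed
  show "voters_of I (cs ! i) = (\<lambda>j. fst (es ! j)) ` ?S"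
  proof (intro equalityI subsetI)
    fix n assume "n \<in> voters_of I (cs ! i)"
    then have "(n, cs ! i) \<in> set es" unfolding voters_of_def set_es by simp
    then obtain j where j: "j < length es" "es ! j = (n, cs ! i)" by (metis in_set_conv_nth)
    then have "nats s ''cand'' j = i"
      using inpD(8,9)[OF assms(1), of j] assms(2) distinct_cs by (auto simp: nth_eq_iff_index_eq)
    then show "n \<in> (\<lambda>j. fst (es ! j)) ` ?S" using j by (intro image_eqI[of _ _ j]) auto
  next
    fix n assume "n \<in> (\<lambda>j. fst (es ! j)) ` ?S"
    then obtain j where "j \<in> ?S" "n = fst (es ! j)" by blast
    then have "(n, cs ! i) \<in> set es" using es[of j] nth_mem[of j es] by (cases "es ! j") auto
    then show "n \<in> voters_of I (cs ! i)" unfolding voters_of_def set_es by simp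
  qed
  show "g (fst (es ! j), cs ! i) = g (es ! j)" if "j \<in> ?S" for j using es[OF that] by (cases "es ! j") simp
qed

lemma edge_sum_voter:
  assumes "inp s" "i < length vs"
  shows "(\<Sum>j | j < length es \<and> nats s ''voter'' j = i. g (es ! j)) = (\<Sum>c\<in>cands_of I (vs ! i). g (vs ! i, c))"
proof (rule sum.reindex_cong[symmetric])
  let ?S = "{j. j < length es \<and> nats s ''voter'' j = i}"
  have es: "fst (es ! j) = vs ! i" if "j \<in> ?S" for j
    using that inpD(9)[OF assms(1), of j] by auto
  show "inj_on (\<lambda>j. snd (es ! j)) ?S"
  proof (rule inj_onI)
    fix j k assume jk: "j \<in> ?S" "k \<in> ?S" "snd (es ! j) = snd (es ! k)"
    then have "es ! j = es ! k" using es[of j] es[of k] by (simp add: prod_eq_iff)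
    then show "j = k" using jk distinct_es by (simp add: nth_eq_iff_index_eq)
  qed
  show "cands_of I (vs ! i) = (\<lambda>j. snd (es ! j)) ` ?S"
  proof (intro equalityI subsetI)
    fix c assume "c \<in> cands_of I (vs ! i)"
    then have "(vs ! i, c) \<in> set es" unfolding cands_of_def set_es by simp
    then obtain j where j: "j < length es" "es ! j = (vs ! i, c)" by (metis in_set_conv_nth)
    then have "nats s ''voter'' j = i"
      using inpD(7,9)[OF assms(1), of j] assms(2) distinct_vs by (auto simp: nth_eq_iff_index_eq)
    then show "c \<in> (\<lambda>j. snd (es ! j)) ` ?S" using j by (intro image_eqI[of _ _ j]) auto
  next
    fix c assume "c \<in> (\<lambda>j. snd (es ! j)) ` ?S"
    then obtain j where "j \<in> ?S" "c = snd (es ! j)" by blast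
    then have "(vs ! i, c) \<in> set es" using es[of j] nth_mem[of j es] by (cases "es ! j") auto
    then show "c \<in> cands_of I (vs ! i)" unfolding cands_of_def set_es by simp
  qed
  show "g (vs ! i, snd (es ! j)) = g (es ! j)" if "j \<in> ?S" for j using es[OF that] by (cases "es ! j") simp
qed

section \<open>Correctness of evaluation and scan\<close>

lemma run_supports:
  assumes inp: "inp s" and w: "\<And>j. j < length es \<Longrightarrow> reals s ''w'' j = W (es ! j)"
  shows "run f supports s (10 * bal) (\<lambda>s'. \<forall>i<length cs. reals s' ''sup'' i = supp I W (cs ! i))"
  unfolding supports_def
proof (rule run_Seq)
  show "run f (rfill ''numcands'' ''sup'' (rnum 0)) s (5 * bal) (\<lambda>s'. \<forall>i<nats s ''numcands'' 0. reals s' ''sup'' i = 0)"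
    using inpD(2)[OF inp] cs_le bal_ge by (intro run_rfill) auto
next
  fix s'
  assume z: "\<forall>i<nats s ''numcands'' 0. reals s' ''sup'' i = 0"
    and fr: "nframe (rfill ''numcands'' ''sup'' (rnum 0)) s s'" "rframe (rfill ''numcands'' ''sup'' (rnum 0)) s s'"
  have inp': "inp s'" by (rule inp_frame[OF inp fr]) auto
  have w': "reals s' ''w'' = reals s ''w''" using rframeD[OF fr(2)] by simp
  have "run f (accum ''numedges'' ''sup'' (NGet ''cand'' J) (RGet ''w'' J)) s' (5 * bal)
     (\<lambda>s''. \<forall>i. reals s'' ''sup'' i = reals s' ''sup'' i + (\<Sum>j | j < nats s' ''numedges'' 0 \<and> nats s' ''cand'' j = i. W (es ! j)))"
    using inpD(3)[OF inp'] es_le bal_ge w w'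
    by (intro run_accum) (auto dest: nframeD[of _ _ _ "''cand''"] rframeD[of _ _ _ "''w''"])
  then show "run f (accum ''numedges'' ''sup'' (NGet ''cand'' J) (RGet ''w'' J)) s' (5 * bal)
     (\<lambda>s'. \<forall>i<length cs. reals s' ''sup'' i = supp I W (cs ! i))"
    by (rule run_mono) (use z inpD(2)[OF inp] inpD(3)[OF inp'] edge_sum_cand[OF inp', where g = W] in \<open>auto simp: supp_def\<close>)
qed simp

lemma run_minimum:
  assumes inp: "inp s"
  shows "run f minimum s (8 * bal) (\<lambda>s'. reals s' ''mn'' 0 \<le> reals s ''thr'' 0 \<and>
     (\<forall>i<length cs. 0 < nats s ''cur'' i \<longrightarrow> reals s' ''mn'' 0 \<le> reals s ''sup'' i) \<and>
     (reals s' ''mn'' 0 = reals s ''thr'' 0 \<or> (\<exists>i<length cs. 0 < nats s ''cur'' i \<and> reals s' ''mn'' 0 = reals s ''sup'' i)))"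
  (is "run f minimum s _ (?Q (length cs))")
  unfolding minimum_def
proof (rule run_Seq)
  show "run f (rset ''mn'' (rvar ''thr'')) s 1 (\<lambda>s'. s' = rupd ''mn'' 0 (reals s ''thr'' 0) s)"
    by (rule run_RSet) auto
next
  fix s' assume s': "s' = rupd ''mn'' 0 (reals s ''thr'' 0) s"
  let ?p = "Cond (BAnd (NLess (NConst 0) (NGet ''cur'' J)) (RLess (RGet ''sup'' J) (rvar ''mn'')))
        (rset ''mn'' (RGet ''sup'' J)) Skip"
  let ?Inv = "\<lambda>m s'. reals s' ''mn'' 0 \<le> reals s ''thr'' 0 \<and>
     (\<forall>i<m. 0 < nats s ''cur'' i \<longrightarrow> reals s' ''mn'' 0 \<le> reals s ''sup'' i) \<and>
     (reals s' ''mn'' 0 = reals s ''thr'' 0 \<or> (\<exists>i<m. 0 < nats s ''cur'' i \<and> reals s' ''mn'' 0 = reals s ''sup'' i))"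
  show "run f (For ''j'' ''numcands'' ?p) s' (7 * bal) (?Q (length cs))"
  proof (rule run_For[where Inv = ?Q and b = 2])
    fix i s''
    assume i: "i < nats s' ''numcands'' 0" "?Inv i s''" "nats s'' ''j'' 0 = i"
      and fr: "nframe (For ''j'' ''numcands'' ?p) s' s''" "rframe (For ''j'' ''numcands'' ?p) s' s''"
    have eq: "nats s'' ''cur'' = nats s ''cur''" "reals s'' ''sup'' = reals s ''sup''"
      using nframeD[OF fr(1)] rframeD[OF fr(2)] s' by simp_all
    show "run f ?p s'' 2 (\<lambda>s'''. ?Inv (Suc i) (nupd ''j'' 0 (Suc i) s'''))"
    proof (rule run_Cond[where b = 1])
      assume "bval (BAnd (NLess (NConst 0) (NGet ''cur'' J)) (RLess (RGet ''sup'' J) (rvar ''mn''))) s''"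
      then show "run f (rset ''mn'' (RGet ''sup'' J)) s'' 1 (\<lambda>s'''. ?Inv (Suc i) (nupd ''j'' 0 (Suc i) s'''))"
        using i eq by (intro run_RSet) (force simp: less_Suc_eq)+
    next
      assume "\<not> bval (BAnd (NLess (NConst 0) (NGet ''cur'' J)) (RLess (RGet ''sup'' J) (rvar ''mn''))) s''"
      then show "run f Skip s'' 1 (\<lambda>s'''. ?Inv (Suc i) (nupd ''j'' 0 (Suc i) s'''))"
        using i eq by (intro run_Skip) (force simp: less_Suc_eq)+
    qed simp
  qed (use s' inpD(2)[OF inp] cs_le bal_ge in auto)
qed (use bal_ge in simp)

lemma comm_sub: "comm s \<subseteq> cands I"
  using decode_sub set_cs by metis

lemma run_call_cur:
  assumes "card (comm s) \<le> seats I"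
  shows "run f (Call ''cur'' ''w'') s bal (\<lambda>s'. \<forall>j<length es. reals s' ''w'' j = solve (comm s) (es ! j))"
  using assms time_le[OF comm_sub]
  by (intro run_Call) (auto simp: subroutine_def Let_def)

lemma run_evaluate:
  assumes inp: "inp s" and card: "card (comm s) \<le> seats I"
  shows "run f evaluate s (19 * bal) (\<lambda>s'. reals s' ''mn'' 0 \<le> reals s ''thr'' 0 \<and>
    hall I (comm s) (reals s' ''mn'' 0) \<and>
    (\<forall>t\<le>reals s ''thr'' 0. hall I (comm s) t \<longrightarrow> t \<le> reals s' ''mn'' 0))"
  (is "run f evaluate s _ ?Q")
  unfolding evaluate_def
proof (rule run_Seq[OF run_call_cur[OF card]])
  let ?W = "solve (comm s)"
  fix s1
  assume w: "\<forall>j<length es. reals s1 ''w'' j = ?W (es ! j)"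
    and fr1: "nframe (Call ''cur'' ''w'') s s1" "rframe (Call ''cur'' ''w'') s s1"
  have inp1: "inp s1" by (rule inp_frame[OF inp fr1]) auto
  show "run f (Seq supports minimum) s1 (18 * bal) ?Q"
  proof (rule run_Seq[OF run_supports[OF inp1]])
    show "reals s1 ''w'' j = ?W (es ! j)" if "j < length es" for j using w that by blast
  next
    fix s2
    assume sup: "\<forall>i<length cs. reals s2 ''sup'' i = supp I ?W (cs ! i)"
      and fr2: "nframe supports s1 s2" "rframe supports s1 s2"
    have inp2: "inp s2" by (rule inp_frame[OF inp1 fr2]) auto
    have eq: "nats s2 ''cur'' = nats s ''cur''" "reals s2 ''thr'' = reals s ''thr''"
      using nframeD[OF fr1(1), of "''cur''"] rframeD[OF fr1(2), of "''thr''"]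
        nframeD[OF fr2(1), of "''cur''"] rframeD[OF fr2(2), of "''thr''"] by simp_all
    have bal: "balanced I (comm s) ?W" by (rule solve_balanced[OF comm_sub card])
    \<comment> \<open>For a balanced vector the supports encode the cut conditions for all
      \<open>t\<close> at once, so one minimum decides them all.\<close>
    have hall: "hall I (comm s) t \<longleftrightarrow> (\<forall>i<length cs. 0 < nats s ''cur'' i \<longrightarrow> t \<le> supp I ?W (cs ! i))" for t
      unfolding hall_iff_supp_ge[OF bal comm_sub] by (auto simp: decode_cands_def)
    show "run f minimum s2 (8 * bal) ?Q"
      by (rule run_mono[OF run_minimum[OF inp2]]) (use sup eq in \<open>auto simp: hall\<close>)
  qed simp
qed simp

lemma run_scan:
  assumes inp: "inp s" and cnt: "nats s ''cnt'' 0 = card (comm s)" "card (comm s) \<le> seats I"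
    and hall: "hall I (comm s) (reals s ''thr'' 0)"
  shows "run f scan s (27 * (bal * real (length cs))) (\<lambda>s'. comm s \<subseteq> comm s' \<and>
    nats s' ''cnt'' 0 = card (comm s') \<and> card (comm s') \<le> seats I \<and>
    hall I (comm s') (reals s ''thr'' 0) \<and>
    (card (comm s') = seats I \<or> (\<forall>c\<in>cands I - comm s'. \<not> hall I (insert c (comm s')) (reals s ''thr'' 0))))"
proof -
  define t where "t = reals s ''thr'' 0"
  \<comment> \<open>A full set releases the scan from justifying what it left out; otherwise each of
    the first \<open>i\<close> candidates outside the set is known not to fit.\<close>
  define Inv where "Inv = (\<lambda>i s'. comm s \<subseteq> comm s' \<and>
    nats s' ''cnt'' 0 = card (comm s') \<and> card (comm s') \<le> seats I \<and> hall I (comm s') t \<and>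
    (card (comm s') = seats I \<or> (\<forall>k<i. cs ! k \<notin> comm s' \<longrightarrow> \<not> hall I (insert (cs ! k) (comm s')) t)))"
  have Inv_cong: "Inv i s1" if "Inv i s2" "nats s1 ''cnt'' = nats s2 ''cnt''" "nats s1 ''cur'' = nats s2 ''cur''" for i s1 s2
    using that unfolding Inv_def by simp
  let ?q = "Cond (RLess (rvar ''mn'') (rvar ''thr''))
             (NSet ''cur'' (nvar ''i'') (NConst 0))
             (nset ''cnt'' (NAdd (nvar ''cnt'') (NConst 1)))"
  let ?c = "BAnd (NLess (nvar ''cnt'') (nvar ''seats'')) (BNot (NLess (NConst 0) (NGet ''cur'' (nvar ''i''))))"
  let ?p = "Cond ?c (Seq (NSet ''cur'' (nvar ''i'') (NConst 1)) (Seq evaluate ?q)) Skip"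
  show ?thesis
    unfolding scan_def t_def[symmetric]
  proof (rule run_For[where Inv = Inv and b = "23 * bal"])
    fix i s'
    assume i: "i < nats s ''numcands'' 0" and inv: "Inv i s'" and ctr: "nats s' ''i'' 0 = i"
      and fr: "nframe (For ''i'' ''numcands'' ?p) s s'" "rframe (For ''i'' ''numcands'' ?p) s s'"
    have inp': "inp s'" by (rule inp_frame[OF inp fr]) auto
    have i: "i < length cs" using i inpD(2)[OF inp] by simp
    have thr: "reals s' ''thr'' 0 = t" using rframeD[OF fr(2), of "''thr''"] by (simp add: t_def)
    let ?R = "\<lambda>s''. Inv (Suc i) (nupd ''i'' 0 (Suc i) s'')"
    show "run f ?p s' (23 * bal) ?R"
    proof (rule run_Cond[where b = "22 * bal"])
      assume "bval ?c s'"
      then have c: "nats s' ''cnt'' 0 < seats I" "nats s' ''cur'' i = 0"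
        using ctr inpD(4)[OF inp'] by simp_all
      let ?A = "comm s'"
      have notin: "cs ! i \<notin> ?A" using c(2) decode_iff[OF distinct_cs i] by blast
      have less: "card ?A < seats I" using c(1) inv unfolding Inv_def by simp
      have finA: "finite ?A" using comm_sub finite_cands finite_subset by blast
      show "run f (Seq (NSet ''cur'' (nvar ''i'') (NConst 1)) (Seq evaluate ?q)) s' (22 * bal) ?R"
      proof (rule run_Seq)
        show "run f (NSet ''cur'' (nvar ''i'') (NConst 1)) s' 1 (\<lambda>s1. s1 = nupd ''cur'' i 1 s')"
          using ctr by (intro run_NSet) auto
      next
        fix s1 assume s1: "s1 = nupd ''cur'' i 1 s'"
        have A1: "comm s1 = insert (cs ! i) ?A" using s1 decode_upd[OF i] by simp
        have inp1: "inp s1" by (rule inp_cong[OF inp']) (auto simp: s1)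
        have card1: "card (comm s1) \<le> seats I" using less notin finA A1 by simp
        show "run f (Seq evaluate ?q) s1 (21 * bal) ?R"
        proof (rule run_Seq[OF run_evaluate[OF inp1 card1]])
          fix s2
          assume ev: "reals s2 ''mn'' 0 \<le> reals s1 ''thr'' 0 \<and> hall I (comm s1) (reals s2 ''mn'' 0) \<and>
            (\<forall>t\<le>reals s1 ''thr'' 0. hall I (comm s1) t \<longrightarrow> t \<le> reals s2 ''mn'' 0)"
            and fr2: "nframe evaluate s1 s2" "rframe evaluate s1 s2"
          have eq2: "nats s2 ''cur'' = (nats s' ''cur'')(i := 1)" "nats s2 ''cnt'' = nats s' ''cnt''"
            "nats s2 ''i'' 0 = i" "reals s2 ''thr'' 0 = t"
            using nframeD[OF fr2(1)] rframeD[OF fr2(2)] s1 ctr thr by simp_all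
          have thr1: "reals s1 ''thr'' 0 = t" using s1 thr by simp
          show "run f ?q s2 (2 * bal) ?R"
          proof (rule run_Cond[where b = 1])
            assume "bval (RLess (rvar ''mn'') (rvar ''thr'')) s2"
            then have no: "\<not> hall I (insert (cs ! i) ?A) t"
              using ev thr1 eq2 unfolding A1 by force
            have "Inv (Suc i) s'" using inv no unfolding Inv_def by (auto simp: less_Suc_eq)
            then show "run f (NSet ''cur'' (nvar ''i'') (NConst 0)) s2 1 ?R"
              by (intro run_NSet) (auto elim!: Inv_cong simp: eq2 c(2) fun_upd_idem)
          next
            assume "\<not> bval (RLess (rvar ''mn'') (rvar ''thr'')) s2"
            then have "reals s2 ''mn'' 0 = t" using ev thr1 eq2 by simp
            then have yes: "hall I (insert (cs ! i) ?A) t" using ev unfolding A1 by simp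
            have "\<not> hall I (insert (cs ! k) (insert (cs ! i) ?A)) t"
              if "k < Suc i" "cs ! k \<notin> insert (cs ! i) ?A" for k
            proof -
              have "k < i" using that by (auto simp: less_Suc_eq)
              then have "\<not> hall I (insert (cs ! k) ?A) t"
                using inv that less unfolding Inv_def by auto
              then show ?thesis using hall_subset by (metis insert_mono subset_insertI)
            qed
            then have "Inv (Suc i) (nupd ''cnt'' 0 (Suc (nats s' ''cnt'' 0)) s2)"
              using inv yes less notin finA A1 s1 unfolding Inv_def by (auto simp: eq2)
            then show "run f (nset ''cnt'' (NAdd (nvar ''cnt'') (NConst 1))) s2 1 ?R"
              by (intro run_NSet) (auto elim!: Inv_cong simp: eq2)
          qed (use bal_ge in simp)
        qed simp
      qed (use bal_ge in simp)
    next
      assume "\<not> bval ?c s'"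
      then have c: "seats I \<le> nats s' ''cnt'' 0 \<or> 0 < nats s' ''cur'' i"
        using ctr inpD(4)[OF inp'] by auto
      then have "card (comm s') = seats I \<or> cs ! i \<in> comm s'"
        using inv decode_iff[OF distinct_cs i] unfolding Inv_def by auto
      then have "Inv (Suc i) s'" using inv unfolding Inv_def by (auto simp: less_Suc_eq)
      then show "run f Skip s' (22 * bal) ?R"
        using bal_ge by (intro run_Skip) (auto elim!: Inv_cong)
    qed (use bal_ge in simp)
  next
    show "Inv 0 (nupd ''i'' 0 0 s)" using cnt hall by (simp add: Inv_def t_def)
  next
    fix s' assume "Inv (nats s ''numcands'' 0) s'"
    moreover have "\<exists>k<length cs. c = cs ! k" if "c \<in> cands I" for c
      using that set_cs by (metis in_set_conv_nth)
    ultimately show "comm s \<subseteq> comm s' \<and>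
      nats s' ''cnt'' 0 = card (comm s') \<and> card (comm s') \<le> seats I \<and> hall I (comm s') t \<and>
      (card (comm s') = seats I \<or> (\<forall>c\<in>cands I - comm s'. \<not> hall I (insert c (comm s')) t))"
      unfolding Inv_def inpD(2)[OF inp] by blast
  next
    show "2 + real (nats s ''numcands'' 0) * (23 * bal + 2) \<le> 27 * (bal * real (length cs))"
      using bal_ge cs_ge mult_right_mono[OF bal_ge, of "real (length cs)"] unfolding inpD(2)[OF inp]
      by (simp add: algebra_simps)
  qed (use bal_ge in auto)
qed

section \<open>Correctness of the greedy phase\<close>

lemma run_loads:
  assumes inp: "inp s" and w: "\<And>j. j < length es \<Longrightarrow> reals s ''w'' j = W (es ! j)"
    and sup: "\<And>i. i < length cs \<Longrightarrow> reals s ''sup'' i = supp I W (cs ! i)"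
  shows "run f loads s (10 * bal) (\<lambda>s'. \<forall>i<length vs. reals s' ''load'' i = load (comm s) W (vs ! i))"
  unfolding loads_def
proof (rule run_Seq)
  show "run f (rfill ''numvoters'' ''load'' (rnum 0)) s (5 * bal) (\<lambda>s'. \<forall>i<nats s ''numvoters'' 0. reals s' ''load'' i = 0)"
    using inpD(1)[OF inp] vs_le bal_ge by (intro run_rfill) auto
next
  fix s'
  assume z: "\<forall>i<nats s ''numvoters'' 0. reals s' ''load'' i = 0"
    and fr: "nframe (rfill ''numvoters'' ''load'' (rnum 0)) s s'" "rframe (rfill ''numvoters'' ''load'' (rnum 0)) s s'"
  have inp': "inp s'" by (rule inp_frame[OF inp fr]) auto
  have eq: "reals s' ''w'' = reals s ''w''" "reals s' ''sup'' = reals s ''sup''" "nats s' ''cur'' = nats s ''cur''"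
    using rframeD[OF fr(2)] nframeD[OF fr(1)] by simp_all
  \<comment> \<open>The program sums over all edges of a voter. Edges to non-members contribute 0,
    which lets \<open>edge_sum_voter\<close> apply before the sum is restricted to the
    committee.\<close>
  define g where "g = (\<lambda>(n, c). if c \<in> comm s then W (n, c) / supp I W c else 0)"
  let ?e = "RMul (RDiv (RNat (NGet ''cur'' (NGet ''cand'' J))) (RNat (NGet ''cur'' (NGet ''cand'' J))))
          (RDiv (RGet ''w'' J) (RGet ''sup'' (NGet ''cand'' J)))"
  let ?p = "accum ''numedges'' ''load'' (NGet ''voter'' J) ?e"
  have "run f ?p s' (5 * bal)
     (\<lambda>s''. \<forall>i. reals s'' ''load'' i = reals s' ''load'' i + (\<Sum>j | j < nats s' ''numedges'' 0 \<and> nats s' ''voter'' j = i. g (es ! j)))"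
  proof (rule run_accum)
    fix j s'' assume j: "j < nats s' ''numedges'' 0" "nats s'' ''j'' 0 = j"
      and fr': "nframe ?p s' s''" "rframe ?p s' s''"
    have eq': "reals s'' ''w'' = reals s ''w''" "reals s'' ''sup'' = reals s ''sup''"
      "nats s'' ''cur'' = nats s ''cur''" "nats s'' ''cand'' = nats s' ''cand''" "nats s'' ''voter'' = nats s' ''voter''"
      using rframeD[OF fr'(2)] nframeD[OF fr'(1)] eq by simp_all
    have j: "j < length es" "nats s'' ''j'' 0 = j" using j inpD(3)[OF inp'] by simp_all
    let ?k = "nats s' ''cand'' j"
    have k: "?k < length cs" using inpD(8)[OF inp'] j by simp
    have "snd (es ! j) = cs ! ?k" using inpD(9)[OF inp' j(1)] by simp
    then have "g (es ! j) = (if nats s ''cur'' ?k \<noteq> 0 then W (es ! j) / supp I W (cs ! ?k) else 0)"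
      using decode_iff[OF distinct_cs k, of "nats s ''cur''"] by (cases "es ! j") (auto simp: g_def)
    then show "nval (NGet ''voter'' J) s'' = nats s' ''voter'' j \<and> rval ?e s'' = g (es ! j)"
      using j k by (simp add: eq' w sup)
  qed (use inpD(3)[OF inp'] es_le bal_ge in auto)
  then show "run f ?p s' (5 * bal) (\<lambda>s'. \<forall>i<length vs. reals s' ''load'' i = load (comm s) W (vs ! i))"
  proof (rule run_mono)
    fix s'' assume *: "\<forall>i. reals s'' ''load'' i = reals s' ''load'' i + (\<Sum>j | j < nats s' ''numedges'' 0 \<and> nats s' ''voter'' j = i. g (es ! j))"
    show "\<forall>i<length vs. reals s'' ''load'' i = load (comm s) W (vs ! i)"
    proof (intro allI impI)
      fix i assume i: "i < length vs"
      have "reals s'' ''load'' i = (\<Sum>c\<in>cands_of I (vs ! i). g (vs ! i, c))"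
        using * z i inpD(1)[OF inp] inpD(3)[OF inp'] edge_sum_voter[OF inp' i, of g] by simp
      also have "\<dots> = load (comm s) W (vs ! i)"
        unfolding load_def g_def using finite_cands_of by (simp add: sum.inter_restrict)
      finally show "reals s'' ''load'' i = load (comm s) W (vs ! i)" .
    qed
  qed simp
qed simp

lemma run_scores:
  assumes inp: "inp s" and load: "\<And>i. i < length vs \<Longrightarrow> reals s ''load'' i = load A W (vs ! i)"
  shows "run f scores s (20 * bal) (\<lambda>s'. \<forall>i<length cs. reals s' ''num'' i / reals s' ''den'' i = score A W (cs ! i))"
proof -
  \<comment> \<open>Numerator and denominator of the score are one computation, with initial value 0
    and 1.\<close>
  have acc: "run f (Seq (rfill ''numcands'' x (rnum k)) (accum ''numedges'' x (NGet ''cand'' J) (RGet y (NGet ''voter'' J)))) s1 (10 * bal)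
      (\<lambda>s'. \<forall>i<length cs. reals s' x i = real k + (\<Sum>n\<in>voters_of I (cs ! i). h n))"
    if inp1: "inp s1" and h: "\<And>i. i < length vs \<Longrightarrow> reals s1 y i = h (vs ! i)"
      and x: "x \<noteq> y" "x \<notin> {''strength'', ''eps''}" for s1 x y k h
  proof (rule run_Seq)
    show "run f (rfill ''numcands'' x (rnum k)) s1 (5 * bal) (\<lambda>s'. \<forall>i<nats s1 ''numcands'' 0. reals s' x i = real k)"
      using inpD(2)[OF inp1] cs_le bal_ge by (intro run_rfill) auto
  next
    let ?p = "accum ''numedges'' x (NGet ''cand'' J) (RGet y (NGet ''voter'' J))"
    fix s2
    assume z: "\<forall>i<nats s1 ''numcands'' 0. reals s2 x i = real k"
      and fr: "nframe (rfill ''numcands'' x (rnum k)) s1 s2" "rframe (rfill ''numcands'' x (rnum k)) s1 s2"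
    have inp2: "inp s2" by (rule inp_frame[OF inp1 fr]) (use x in auto)
    have y: "reals s2 y = reals s1 y" using rframeD[OF fr(2)] x by simp
    have "run f ?p s2 (5 * bal)
       (\<lambda>s''. \<forall>i. reals s'' x i = reals s2 x i + (\<Sum>j | j < nats s2 ''numedges'' 0 \<and> nats s2 ''cand'' j = i. (\<lambda>(n, c). h n) (es ! j)))"
    proof (rule run_accum)
      fix j s'' assume j: "j < nats s2 ''numedges'' 0" "nats s'' ''j'' 0 = j"
        and fr': "nframe ?p s2 s''" "rframe ?p s2 s''"
      have eq': "reals s'' y = reals s1 y" "nats s'' ''cand'' = nats s2 ''cand''" "nats s'' ''voter'' = nats s2 ''voter''"
        using rframeD[OF fr'(2)] nframeD[OF fr'(1)] y x by simp_all
      have "j < length es" using j inpD(3)[OF inp2] by simp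
      then show "nval (NGet ''cand'' J) s'' = nats s2 ''cand'' j \<and> rval (RGet y (NGet ''voter'' J)) s'' = (\<lambda>(n, c). h n) (es ! j)"
        using j inpD(7,9)[OF inp2, of j] by (simp add: eq' h)
    qed (use inpD(3)[OF inp2] es_le bal_ge in auto)
    then show "run f ?p s2 (5 * bal) (\<lambda>s'. \<forall>i<length cs. reals s' x i = real k + (\<Sum>n\<in>voters_of I (cs ! i). h n))"
      by (rule run_mono)
        (use z inpD(2)[OF inp1] inpD(3)[OF inp2] edge_sum_cand[OF inp2, where g = "\<lambda>(n, c). h n"] in auto)
  qed simp
  let ?p1 = "rfill ''numcands'' ''num'' (rnum 0)"
  let ?p2 = "accum ''numedges'' ''num'' (NGet ''cand'' J) (RGet ''strength'' (NGet ''voter'' J))"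
  let ?q = "Seq (rfill ''numcands'' ''den'' (rnum 1)) (accum ''numedges'' ''den'' (NGet ''cand'' J) (RGet ''load'' (NGet ''voter'' J)))"
  have "run f (Seq (Seq ?p1 ?p2) ?q) s (20 * bal)
    (\<lambda>s'. \<forall>i<length cs. reals s' ''num'' i / reals s' ''den'' i = score A W (cs ! i))"
  proof (rule run_Seq)
    show "run f (Seq ?p1 ?p2) s (10 * bal)
       (\<lambda>s'. \<forall>i<length cs. reals s' ''num'' i = real 0 + (\<Sum>n\<in>voters_of I (cs ! i). strength I n))"
      using inpD(6)[OF inp] by (intro acc[OF inp]) auto
  next
    fix s1
    assume num: "\<forall>i<length cs. reals s1 ''num'' i = real 0 + (\<Sum>n\<in>voters_of I (cs ! i). strength I n)"
      and fr: "nframe (Seq ?p1 ?p2) s s1" "rframe (Seq ?p1 ?p2) s s1"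
    have inp1: "inp s1" by (rule inp_frame[OF inp fr]) auto
    have load1: "reals s1 ''load'' = reals s ''load''" using rframeD[OF fr(2)] by simp
    show "run f ?q s1 (10 * bal) (\<lambda>s'. \<forall>i<length cs. reals s' ''num'' i / reals s' ''den'' i = score A W (cs ! i))"
    proof (rule run_mono)
      show "run f ?q s1 (10 * bal) (\<lambda>s'. \<forall>i<length cs. reals s' ''den'' i = real 1 + (\<Sum>n\<in>voters_of I (cs ! i). load A W n))"
        using load load1 by (intro acc[OF inp1]) auto
    next
      fix s2
      assume den: "\<forall>i<length cs. reals s2 ''den'' i = real 1 + (\<Sum>n\<in>voters_of I (cs ! i). load A W n)"
        and fr2: "rframe ?q s1 s2"
      have "reals s2 ''num'' = reals s1 ''num''" using rframeD[OF fr2] by simp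
      then show "\<forall>i<length cs. reals s2 ''num'' i / reals s2 ''den'' i = score A W (cs ! i)"
        using num den by (simp add: score_def)
    qed simp
  qed simp
  then show ?thesis unfolding scores_def .
qed

lemma run_pick:
  assumes inp: "inp s"
    and sc: "\<And>i. i < length cs \<Longrightarrow> reals s ''num'' i / reals s ''den'' i = sc i" "\<And>i. i < length cs \<Longrightarrow> 0 \<le> sc i"
    and ex: "\<exists>i<length cs. nats s ''cur'' i = 0"
  shows "run f pick s (9 * bal) (\<lambda>s'. nats s' ''best'' 0 < length cs \<and> nats s ''cur'' (nats s' ''best'' 0) = 0 \<and>
     (\<forall>i<length cs. nats s ''cur'' i = 0 \<longrightarrow> sc i \<le> sc (nats s' ''best'' 0)))"
  (is "run f pick s _ ?Q")
  unfolding pick_def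
proof (rule run_Seq)
  show "run f (rset ''bs'' (rnum 0)) s 1 (\<lambda>s'. s' = rupd ''bs'' 0 0 s)"
    by (rule run_RSet) auto
next
  fix s' assume s': "s' = rupd ''bs'' 0 0 s"
  let ?c = "BAnd (BNot (NLess (NConst 0) (NGet ''cur'' J)))
                (BNot (RLess (RDiv (RGet ''num'' J) (RGet ''den'' J)) (rvar ''bs'')))"
  let ?q = "rset ''bs'' (RDiv (RGet ''num'' J) (RGet ''den'' J))"
  let ?p = "Cond ?c (Seq (nset ''best'' J) ?q) Skip"
  \<comment> \<open>By the last conjunct a nonzero \<open>bs\<close> proves that an outsider has
    been met. This is what shows \<open>best\<close> to be meaningful when an outsider is passed
    over for a smaller score.\<close>
  define Inv where "Inv = (\<lambda>m (s' :: store). 0 \<le> reals s' ''bs'' 0 \<and> (\<forall>i<m. nats s ''cur'' i = 0 \<longrightarrow> sc i \<le> reals s' ''bs'' 0) \<and>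
    ((\<exists>i<m. nats s ''cur'' i = 0) \<longrightarrow> nats s' ''best'' 0 < m \<and> nats s ''cur'' (nats s' ''best'' 0) = 0 \<and> reals s' ''bs'' 0 = sc (nats s' ''best'' 0)) \<and>
    ((\<forall>i<m. nats s ''cur'' i \<noteq> 0) \<longrightarrow> reals s' ''bs'' 0 = 0))"
  have Inv_cong: "Inv m s1" if "Inv m s2" "reals s1 ''bs'' = reals s2 ''bs''" "nats s1 ''best'' = nats s2 ''best''" for m s1 s2
    using that unfolding Inv_def by simp
  show "run f (For ''j'' ''numcands'' ?p) s' (8 * bal) ?Q"
  proof (rule run_For[where Inv = Inv and b = 3])
    fix m s''
    assume m: "m < nats s' ''numcands'' 0" and inv: "Inv m s''" and ctr: "nats s'' ''j'' 0 = m"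
      and fr: "nframe (For ''j'' ''numcands'' ?p) s' s''" "rframe (For ''j'' ''numcands'' ?p) s' s''"
    have m: "m < length cs" using m s' inpD(2)[OF inp] by simp
    have eq: "nats s'' ''cur'' = nats s ''cur''" "reals s'' ''num'' = reals s ''num''" "reals s'' ''den'' = reals s ''den''"
      using nframeD[OF fr(1)] rframeD[OF fr(2)] s' by simp_all
    have scm: "reals s'' ''num'' m / reals s'' ''den'' m = sc m" using sc(1)[OF m] eq by simp
    let ?R = "\<lambda>s'''. Inv (Suc m) (nupd ''j'' 0 (Suc m) s''')"
    show "run f ?p s'' 3 ?R"
    proof (rule run_Cond[where b = 2])
      assume "bval ?c s''"
      then have c: "nats s ''cur'' m = 0" "reals s'' ''bs'' 0 \<le> sc m" using ctr scm eq by auto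
      show "run f (Seq (nset ''best'' J) ?q) s'' 2 ?R"
      proof (rule run_Seq)
        show "run f (nset ''best'' J) s'' 1 (\<lambda>s1. s1 = nupd ''best'' 0 m s'')"
          using ctr by (intro run_NSet) auto
      next
        fix s1 assume s1: "s1 = nupd ''best'' 0 m s''"
        have "Inv (Suc m) (rupd ''bs'' 0 (sc m) s1)"
          unfolding Inv_def
        proof (intro conjI allI impI)
          fix k assume "k < Suc m" "nats s ''cur'' k = 0"
          then have "k = m \<or> sc k \<le> reals s'' ''bs'' 0" using inv unfolding Inv_def by (simp add: less_Suc_eq) blast
          then show "sc k \<le> reals (rupd ''bs'' 0 (sc m) s1) ''bs'' 0" using c(2) by auto
        qed (use c(1) sc(2)[OF m] s1 in auto)
        then show "run f ?q s1 1 ?R"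
          using ctr scm s1 by (intro run_RSet) (auto elim!: Inv_cong)
      qed simp
    next
      assume "\<not> bval ?c s''"
      then have c: "nats s ''cur'' m \<noteq> 0 \<or> sc m < reals s'' ''bs'' 0" using ctr scm eq by auto
      have "Inv (Suc m) s''"
      proof (cases "nats s ''cur'' m = 0")
        case True
        then have lt: "sc m < reals s'' ''bs'' 0" using c by simp
        then have "reals s'' ''bs'' 0 \<noteq> 0" using sc(2)[OF m] by simp
        moreover have "(\<forall>i<m. nats s ''cur'' i \<noteq> 0) \<longrightarrow> reals s'' ''bs'' 0 = 0"
          using inv unfolding Inv_def by (elim conjE)
        ultimately obtain k where k: "k < m" "nats s ''cur'' k = 0" by blast
        have "nats s'' ''best'' 0 < m \<and> nats s ''cur'' (nats s'' ''best'' 0) = 0 \<and> reals s'' ''bs'' 0 = sc (nats s'' ''best'' 0)"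
          using inv k unfolding Inv_def by (elim conjE) blast
        moreover have "\<forall>i<m. nats s ''cur'' i = 0 \<longrightarrow> sc i \<le> reals s'' ''bs'' 0"
          using inv unfolding Inv_def by (elim conjE)
        moreover have "0 \<le> reals s'' ''bs'' 0"
          using inv unfolding Inv_def by (elim conjE)
        ultimately show ?thesis using lt k unfolding Inv_def by (metis less_Suc_eq less_imp_le)
      next
        case False
        then have "(\<forall>i<Suc m. nats s ''cur'' i = 0 \<longrightarrow> P i) \<longleftrightarrow> (\<forall>i<m. nats s ''cur'' i = 0 \<longrightarrow> P i)" for P
          by (auto simp: less_Suc_eq)
        moreover have "(\<exists>i<Suc m. nats s ''cur'' i = 0) \<longleftrightarrow> (\<exists>i<m. nats s ''cur'' i = 0)"
          using False by (auto simp: less_Suc_eq)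
        moreover have "(\<forall>i<Suc m. nats s ''cur'' i \<noteq> 0) \<longleftrightarrow> (\<forall>i<m. nats s ''cur'' i \<noteq> 0)"
          using False by (auto simp: less_Suc_eq)
        ultimately show ?thesis using inv unfolding Inv_def by (simp only: simp_thms) (meson less_SucI)
      qed
      then show "run f Skip s'' 2 ?R" by (intro run_Skip) (auto elim!: Inv_cong)
    qed simp
  next
    show "Inv 0 (nupd ''j'' 0 0 s')" by (simp add: Inv_def s')
  next
    fix s'' assume "Inv (nats s' ''numcands'' 0) s''"
    then show "?Q s''" using ex s' inpD(2)[OF inp] unfolding Inv_def by auto
  qed (use s' inpD(2)[OF inp] cs_le bal_ge in auto)
qed (use bal_ge in simp)

lemma run_greedy:
  assumes inp: "inp s" and cnt: "nats s ''cnt'' 0 = card (comm s)" "card (comm s) \<le> seats I"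
  shows "run f greedy s (57 * (bal * real (length cs))) (\<lambda>s'. comm s \<subseteq> comm s' \<and> card (comm s') = seats I \<and>
    (\<forall>t B. 0 < t \<longrightarrow> B \<subseteq> cands I \<longrightarrow> card B = seats I \<longrightarrow> hall I B (4 * t) \<longrightarrow> hall I (comm s) t \<longrightarrow> hall I (comm s') t))"
proof -
  \<comment> \<open>The program does not know the optimum, so the claim is kept for all
    \<open>t\<close> simultaneously. The conjunct with \<open>min\<close> forces the committee to be
    full in the end.\<close>
  define Inv where "Inv = (\<lambda>i s'. comm s \<subseteq> comm s' \<and>
    nats s' ''cnt'' 0 = card (comm s') \<and> card (comm s') \<le> seats I \<and> min i (seats I) \<le> card (comm s') \<and>
    (\<forall>t B. 0 < t \<longrightarrow> B \<subseteq> cands I \<longrightarrow> card B = seats I \<longrightarrow> hall I B (4 * t) \<longrightarrow> hall I (comm s) t \<longrightarrow> hall I (comm s') t))"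
  have Inv_cong: "Inv i s1" if "Inv i s2" "nats s1 ''cnt'' = nats s2 ''cnt''" "nats s1 ''cur'' = nats s2 ''cur''" for i s1 s2
    using that unfolding Inv_def by simp
  let ?inc = "nset ''cnt'' (NAdd (nvar ''cnt'') (NConst 1))"
  let ?add = "NSet ''cur'' (nvar ''best'') (NConst 1)"
  let ?c = "NLess (nvar ''cnt'') (nvar ''seats'')"
  let ?p = "Cond ?c (Seq (Call ''cur'' ''w'') (Seq supports (Seq loads (Seq scores (Seq pick (Seq ?add ?inc)))))) Skip"
  show ?thesis
    unfolding greedy_def
  proof (rule run_For[where Inv = Inv and b = "53 * bal"])
    fix i s0
    assume i: "i < nats s ''numcands'' 0" and inv: "Inv i s0" and ctr: "nats s0 ''i'' 0 = i"
      and fr: "nframe (For ''i'' ''numcands'' ?p) s s0" "rframe (For ''i'' ''numcands'' ?p) s s0"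
    have inp0: "inp s0" by (rule inp_frame[OF inp fr]) auto
    let ?R = "\<lambda>s''. Inv (Suc i) (nupd ''i'' 0 (Suc i) s'')"
    show "run f ?p s0 (53 * bal) ?R"
    proof (rule run_Cond[where b = "52 * bal"])
      assume "bval ?c s0"
      then have less: "card (comm s0) < seats I" using inv inpD(4)[OF inp0] unfolding Inv_def by simp
      define A where "A = comm s0"
      define W where "W = solve A"
      have A: "A \<subseteq> cands I" using comm_sub by (simp add: A_def)
      have finA: "finite A" using A finite_cands finite_subset by blast
      have bal: "balanced I A W" unfolding W_def using less A by (intro solve_balanced) (auto simp: A_def)
      have feas: "feasible I W" using bal by (rule balanced_feasible)
      have cardA: "card (comm s0) \<le> seats I" using less by simp
      show "run f (Seq (Call ''cur'' ''w'') (Seq supports (Seq loads (Seq scores (Seq pick (Seq ?add ?inc)))))) s0 (52 * bal) ?R"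
      proof (rule run_Seq[OF run_call_cur[OF cardA]])
        fix s1
        assume w1: "\<forall>j<length es. reals s1 ''w'' j = solve (comm s0) (es ! j)"
          and fr: "nframe (Call ''cur'' ''w'') s0 s1" "rframe (Call ''cur'' ''w'') s0 s1"
        have inp1: "inp s1" by (rule inp_frame[OF inp0 fr]) auto
        have eq1: "nats s1 ''cur'' = nats s0 ''cur''" "nats s1 ''cnt'' = nats s0 ''cnt''"
          using nframeD[OF fr(1)] by simp_all
        have w1: "reals s1 ''w'' j = W (es ! j)" if "j < length es" for j
          using w1 that by (simp add: W_def A_def)
        show "run f (Seq supports (Seq loads (Seq scores (Seq pick (Seq ?add ?inc))))) s1 (51 * bal) ?R"
        proof (rule run_Seq[OF run_supports[where W = W, OF inp1 w1]])
          fix s2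
          assume sup2: "\<forall>i<length cs. reals s2 ''sup'' i = supp I W (cs ! i)"
            and fr: "nframe supports s1 s2" "rframe supports s1 s2"
          have inp2: "inp s2" by (rule inp_frame[OF inp1 fr]) auto
          have eq2: "nats s2 ''cur'' = nats s0 ''cur''" "nats s2 ''cnt'' = nats s0 ''cnt''" "reals s2 ''w'' = reals s1 ''w''"
            using nframeD[OF fr(1)] rframeD[OF fr(2)] eq1 by simp_all
          have comm2: "comm s2 = A" by (simp add: eq2 A_def)
          show "run f (Seq loads (Seq scores (Seq pick (Seq ?add ?inc)))) s2 (41 * bal) ?R"
          proof (rule run_Seq[OF run_loads[where W = W, OF inp2]])
            fix s3
            assume load3: "\<forall>i<length vs. reals s3 ''load'' i = load (comm s2) W (vs ! i)"
              and fr: "nframe loads s2 s3" "rframe loads s2 s3"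
            have inp3: "inp s3" by (rule inp_frame[OF inp2 fr]) auto
            have eq3: "nats s3 ''cur'' = nats s0 ''cur''" "nats s3 ''cnt'' = nats s0 ''cnt''"
              using nframeD[OF fr(1)] eq2 by simp_all
            show "run f (Seq scores (Seq pick (Seq ?add ?inc))) s3 (31 * bal) ?R"
            proof (rule run_Seq[OF run_scores[where W = W and A = A, OF inp3]])
              fix s4
              assume sc4: "\<forall>i<length cs. reals s4 ''num'' i / reals s4 ''den'' i = score A W (cs ! i)"
                and fr: "nframe scores s3 s4" "rframe scores s3 s4"
              have inp4: "inp s4" by (rule inp_frame[OF inp3 fr]) auto
              have eq4: "nats s4 ''cur'' = nats s0 ''cur''" "nats s4 ''cnt'' = nats s0 ''cnt''"
                using nframeD[OF fr(1)] eq3 by simp_all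
              show "run f (Seq pick (Seq ?add ?inc)) s4 (11 * bal) ?R"
              proof (rule run_Seq[OF run_pick[where sc = "\<lambda>i. score A W (cs ! i)", OF inp4]])
                show "\<exists>i<length cs. nats s4 ''cur'' i = 0"
                proof (rule ccontr)
                  assume "\<not> ?thesis"
                  then have "set cs \<subseteq> A" using decode_iff[OF distinct_cs] unfolding A_def eq4 by (metis in_set_conv_nth subsetI)
                  then have "card (cands I) \<le> card A" using set_cs finA card_mono by metis
                  then show False using less seats_less by (simp add: A_def)
                qed
              next
                fix s5
                assume best: "nats s5 ''best'' 0 < length cs \<and> nats s4 ''cur'' (nats s5 ''best'' 0) = 0 \<and>
                   (\<forall>i<length cs. nats s4 ''cur'' i = 0 \<longrightarrow> score A W (cs ! i) \<le> score A W (cs ! nats s5 ''best'' 0))"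
                  and fr: "nframe pick s4 s5" "rframe pick s4 s5"
                define b where "b = nats s5 ''best'' 0"
                define c where "c = cs ! b"
                have b: "b < length cs" "nats s0 ''cur'' b = 0" using best eq4 by (auto simp: b_def)
                have cA: "c \<notin> A" using decode_iff[OF distinct_cs b(1)] b(2) by (simp add: c_def A_def)
                have max: "score A W d \<le> score A W c" if d: "d \<in> cands I - A" for d
                proof -
                  obtain i where "i < length cs" "d = cs ! i" using d set_cs by (metis DiffD1 in_set_conv_nth)
                  moreover from this have "nats s0 ''cur'' i = 0"
                    using d decode_iff[OF distinct_cs] by (auto simp: A_def)
                  ultimately show ?thesis using best eq4 by (auto simp: c_def b_def)
                qed
                \<comment> \<open>Only positive \<open>t\<close> that \<open>A\<close> itself
                  attains are considered, so all supports in \<open>A\<close> are positive here and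
                  the quotients in \<open>load\<close> are genuine.\<close>
                have step: "hall I (insert c A) t"
                  if t: "0 < t" "B \<subseteq> cands I" "card B = seats I" "hall I B (4 * t)" "hall I A t" for t B
                proof -
                  have "\<exists>d\<in>cands I - A. t \<le> score A W d"
                    using t less by (intro exists_score_ge[OF bal A]) (auto simp: A_def)
                  then have "t \<le> score A W c" using max by force
                  then show ?thesis
                    using balanced_supp_ge[OF bal A t(5)] by (intro hall_insert_if_score_ge[OF feas A t(1)])
                qed
                have eq5: "nats s5 ''cur'' = nats s0 ''cur''" "nats s5 ''cnt'' = nats s0 ''cnt''"
                  using nframeD[OF fr(1)] eq4 by simp_all
                show "run f (Seq ?add ?inc) s5 (2 * bal) ?R"
                proof (rule run_Seq)
                  show "run f ?add s5 1 (\<lambda>s6. s6 = nupd ''cur'' b 1 s5)"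
                    by (intro run_NSet) (auto simp: b_def)
                next
                  fix s6 assume s6: "s6 = nupd ''cur'' b 1 s5"
                  have comm6: "comm s6 = insert c A" using decode_upd[OF b(1)] by (simp add: s6 eq5 A_def c_def)
                  have cnt6: "nats s6 ''cnt'' = nats s0 ''cnt''" by (simp add: s6 eq5)
                  have "Inv (Suc i) (nupd ''cnt'' 0 (Suc (nats s0 ''cnt'' 0)) s6)"
                    using inv less step cA finA comm6 unfolding Inv_def A_def[symmetric] by auto
                  then show "run f ?inc s6 1 ?R"
                    by (intro run_NSet) (auto elim!: Inv_cong simp: cnt6)
                qed (use bal_ge in simp)
              qed (use sc4 score_nonneg[OF feas] in auto)
            qed (use load3 comm2 in auto)
          qed (use sup2 eq2 w1 in auto)
        qed auto
      qed simp
    next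
      assume "\<not> bval ?c s0"
      then have "card (comm s0) = seats I" using inv inpD(4)[OF inp0] unfolding Inv_def by simp
      then have "Inv (Suc i) s0" using inv unfolding Inv_def by auto
      then show "run f Skip s0 (52 * bal) ?R"
        using bal_ge by (intro run_Skip) (auto elim!: Inv_cong)
    qed (use bal_ge in simp)
  next
    show "Inv 0 (nupd ''i'' 0 0 s)" using cnt by (simp add: Inv_def)
  next
    fix s' assume "Inv (nats s ''numcands'' 0) s'"
    then show "comm s \<subseteq> comm s' \<and> card (comm s') = seats I \<and>
      (\<forall>t B. 0 < t \<longrightarrow> B \<subseteq> cands I \<longrightarrow> card B = seats I \<longrightarrow> hall I B (4 * t) \<longrightarrow> hall I (comm s) t \<longrightarrow> hall I (comm s') t)"
      using seats_less unfolding Inv_def inpD(2)[OF inp] length_cs by auto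
  next
    show "2 + real (nats s ''numcands'' 0) * (53 * bal + 2) \<le> 57 * (bal * real (length cs))"
      using bal_ge cs_ge mult_right_mono[OF bal_ge, of "real (length cs)"] unfolding inpD(2)[OF inp]
      by (simp add: algebra_simps)
  qed (use bal_ge in auto)
qed

section \<open>Correctness of the bisection\<close>

abbreviation base :: "store \<Rightarrow> 'c set" where "base s \<equiv> decode_cands cs (nats s ''base'')"
abbreviation best :: "store \<Rightarrow> 'c set" where "best s \<equiv> decode_cands cs (nats s ''committee'')"
abbreviation lo :: "store \<Rightarrow> real" where "lo s \<equiv> reals s ''lo'' 0"
abbreviation up :: "store \<Rightarrow> real" where "up s \<equiv> reals s ''up'' 0"

definition quota_maximal :: "'c set \<Rightarrow> bool" where
  "quota_maximal A \<longleftrightarrow> A \<subseteq> cands I \<and> card A \<le> seats I \<and> hall I A quota \<and>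
     (card A = seats I \<or> (\<forall>c\<in>cands I - A. \<not> hall I (insert c A) quota))"

text \<open>Competitors are bounded through Hall thresholds because that is what a failed scan
  yields; \<open>opt_le\<close> converts the bound at the end. The condition
  \<open>up s \<le> quota\<close> is what lets \<open>base s\<close> pass the test at every
  midpoint.\<close>

definition bracket :: "store \<Rightarrow> bool" where
  "bracket s \<longleftrightarrow> inp s \<and> quota_maximal (base s) \<and> nats s ''bcnt'' 0 = card (base s) \<and>
     base s \<subseteq> best s \<and> card (best s) = seats I \<and> hall I (best s) (lo s) \<and>
     0 \<le> lo s \<and> lo s \<le> up s \<and> up s \<le> quota \<and>
     (\<forall>B v. B \<subseteq> cands I \<longrightarrow> card B = seats I \<longrightarrow> hall I B v \<longrightarrow> v \<le> 2 * up s)"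

lemma bracket_cong:
  assumes "bracket s" "inp s'" "nats s' ''base'' = nats s ''base''" "nats s' ''bcnt'' = nats s ''bcnt''"
    "nats s' ''committee'' = nats s ''committee''" "lo s' = lo s" "up s' = up s"
  shows "bracket s'"
  using assms unfolding bracket_def by simp

lemma bal_le: "bal \<le> bal * real (length cs)"
  using bal_ge cs_ge by (simp add: mult_le_cancel_left1)

lemma run_copy:
  assumes "inp s" "x \<noteq> ''j''" "y \<noteq> ''j''" "x \<noteq> y" "x \<noteq> ''numcands''"
  shows "run f (nfill ''numcands'' x (NGet y J)) s (5 * bal)
    (\<lambda>s'. decode_cands cs (nats s' x) = decode_cands cs (nats s y))"
proof (rule run_mono)
  show "run f (nfill ''numcands'' x (NGet y J)) s (5 * bal) (\<lambda>s'. \<forall>i<nats s ''numcands'' 0. nats s' x i = nats s y i)"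
  proof (rule run_nfill)
    fix j s' assume "nats s' ''j'' 0 = j" "nframe (nfill ''numcands'' x (NGet y J)) s s'"
    then show "nval (NGet y J) s' = nats s y j"
      using nframeD[of _ s s' y] assms by fastforce
  qed (use assms inpD(2)[OF assms(1)] cs_le bal_ge in auto)
  fix s' assume "\<forall>i<nats s ''numcands'' 0. nats s' x i = nats s y i"
  then show "decode_cands cs (nats s' x) = decode_cands cs (nats s y)"
    using inpD(2)[OF assms(1)] by (intro decode_cong) simp
qed simp

lemma run_bisect:
  assumes br: "bracket s"
  shows "run f bisect s (41 * (bal * real (length cs))) (\<lambda>s'. bracket s' \<and> lo s \<le> lo s' \<and>
    up s' - lo s' = (up s - lo s) / 2)" (is "run f bisect s _ ?Q")
  unfolding bisect_def
proof (rule run_Seq)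
  define t where "t = (lo s + up s) / 2"
  have t: "0 \<le> t" "lo s \<le> t" "t \<le> up s" "t \<le> quota"
    using br unfolding bracket_def t_def by auto
  show "run f (rset ''thr'' (RDiv (RAdd (rvar ''lo'') (rvar ''up'')) (rnum 2))) s 1 (\<lambda>s1. s1 = rupd ''thr'' 0 t s)"
    by (intro run_RSet) (auto simp: t_def)
  fix s1 assume s1: "s1 = rupd ''thr'' 0 t s"
  have inp0: "inp s" using br by (simp add: bracket_def)
  have inp1: "inp s1" by (rule inp_cong[OF inp0]) (auto simp: s1)
  let ?q = "Cond (NLess (nvar ''cnt'') (nvar ''seats''))
        (rset ''up'' (rvar ''thr''))
        (Seq (rset ''lo'' (rvar ''thr'')) (nfill ''numcands'' ''committee'' (NGet ''cur'' J)))"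
  show "run f (Seq (nfill ''numcands'' ''cur'' (NGet ''base'' J)) (Seq (nset ''cnt'' (nvar ''bcnt'')) (Seq scan ?q))) s1
      (40 * (bal * real (length cs))) ?Q"
  proof (rule run_Seq[OF run_copy[OF inp1]])
    fix s2
    assume cur2: "comm s2 = base s1"
      and fr: "nframe (nfill ''numcands'' ''cur'' (NGet ''base'' J)) s1 s2" "rframe (nfill ''numcands'' ''cur'' (NGet ''base'' J)) s1 s2"
    have inp2: "inp s2" by (rule inp_frame[OF inp1 fr]) auto
    have eq2: "nats s2 ''base'' = nats s ''base''" "nats s2 ''bcnt'' = nats s ''bcnt''"
      "nats s2 ''committee'' = nats s ''committee''" "reals s2 ''lo'' = reals s ''lo''"
      "reals s2 ''up'' = reals s ''up''" "reals s2 ''thr'' 0 = t"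
      using nframeD[OF fr(1)] rframeD[OF fr(2)] by (simp_all add: s1)
    have cur2: "comm s2 = base s" using cur2 by (simp add: s1)
    show "run f (Seq (nset ''cnt'' (nvar ''bcnt'')) (Seq scan ?q)) s2 (35 * (bal * real (length cs))) ?Q"
    proof (rule run_Seq)
      show "run f (nset ''cnt'' (nvar ''bcnt'')) s2 1 (\<lambda>s3. s3 = nupd ''cnt'' 0 (nats s ''bcnt'' 0) s2)"
        by (intro run_NSet) (auto simp: eq2)
      fix s3 assume s3: "s3 = nupd ''cnt'' 0 (nats s ''bcnt'' 0) s2"
      have inp3: "inp s3" by (rule inp_cong[OF inp2]) (auto simp: s3)
      have comm3: "comm s3 = base s" by (simp add: s3 cur2)
      have scan3: "nats s3 ''cnt'' 0 = card (comm s3)" "card (comm s3) \<le> seats I" "hall I (comm s3) (reals s3 ''thr'' 0)"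
        unfolding comm3 using br t hall_antimono[of I "base s" quota t]
        by (auto simp: s3 eq2 bracket_def quota_maximal_def)
      show "run f (Seq scan ?q) s3 (34 * (bal * real (length cs))) ?Q"
      proof (rule run_Seq[OF run_scan[OF inp3 scan3]])
        fix s4
        assume sc: "comm s3 \<subseteq> comm s4 \<and> nats s4 ''cnt'' 0 = card (comm s4) \<and> card (comm s4) \<le> seats I \<and>
            hall I (comm s4) (reals s3 ''thr'' 0) \<and>
            (card (comm s4) = seats I \<or> (\<forall>c\<in>cands I - comm s4. \<not> hall I (insert c (comm s4)) (reals s3 ''thr'' 0)))"
          and fr: "nframe scan s3 s4" "rframe scan s3 s4"
        have inp4: "inp s4" by (rule inp_frame[OF inp3 fr]) auto
        have eq4: "nats s4 ''base'' = nats s ''base''" "nats s4 ''bcnt'' = nats s ''bcnt''"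
          "nats s4 ''committee'' = nats s ''committee''" "reals s4 ''lo'' = reals s ''lo''"
          "reals s4 ''up'' = reals s ''up''" "reals s4 ''thr'' 0 = t" "reals s3 ''thr'' 0 = t"
          using nframeD[OF fr(1)] rframeD[OF fr(2)] by (simp_all add: s3 eq2)
        have br4: "bracket s4" using br inp4 by (rule bracket_cong) (simp_all add: eq4)
        show "run f ?q s4 (7 * (bal * real (length cs))) ?Q"
        proof (rule run_Cond[where b = "6 * bal"])
          assume "bval (NLess (nvar ''cnt'') (nvar ''seats'')) s4"
          then have less: "card (comm s4) < seats I" using sc inpD(4)[OF inp4] by simp
          have "v \<le> 2 * t" if B: "B \<subseteq> cands I" "card B = seats I" "hall I B v" for B v
          proof (rule ccontr)
            assume "\<not> v \<le> 2 * t"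
            then have "hall I B (2 * t)" using hall_antimono[OF B(3)] by simp
            moreover have "hall I (comm s4) t" and "\<not> hall I (insert c (comm s4)) t" if "c \<in> cands I - comm s4" for c
              using sc less that unfolding eq4 by simp_all
            ultimately show False
              using maximal_half_optimal[OF _ comm_sub less t(1) _ B(1,2)] sc eq4 by metis
          qed
          moreover have "inp (rupd ''up'' 0 t s4)" by (rule inp_cong[OF inp4]) auto
          ultimately have "bracket (rupd ''up'' 0 t s4)"
            using br4 t unfolding bracket_def by (simp add: eq4)
          then show "run f (rset ''up'' (rvar ''thr'')) s4 (6 * bal) ?Q"
            using bal_ge by (intro run_RSet) (auto simp: eq4 t_def field_simps)
        next
          assume "\<not> bval (NLess (nvar ''cnt'') (nvar ''seats'')) s4"
          then have full: "card (comm s4) = seats I" using sc inpD(4)[OF inp4] by simp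
          show "run f (Seq (rset ''lo'' (rvar ''thr'')) (nfill ''numcands'' ''committee'' (NGet ''cur'' J))) s4 (6 * bal) ?Q"
          proof (rule run_Seq)
            show "run f (rset ''lo'' (rvar ''thr'')) s4 1 (\<lambda>s5. s5 = rupd ''lo'' 0 t s4)"
              by (intro run_RSet) (auto simp: eq4)
            fix s5 assume s5: "s5 = rupd ''lo'' 0 t s4"
            have inp5: "inp s5" by (rule inp_cong[OF inp4]) (auto simp: s5)
            show "run f (nfill ''numcands'' ''committee'' (NGet ''cur'' J)) s5 (5 * bal) ?Q"
            proof (rule run_mono[OF run_copy[OF inp5]])
              fix s6
              assume best: "best s6 = comm s5"
                and fr: "nframe (nfill ''numcands'' ''committee'' (NGet ''cur'' J)) s5 s6" "rframe (nfill ''numcands'' ''committee'' (NGet ''cur'' J)) s5 s6"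
              have inp6: "inp s6" by (rule inp_frame[OF inp5 fr]) auto
              have eq6: "nats s6 ''base'' = nats s ''base''" "nats s6 ''bcnt'' = nats s ''bcnt''"
                "lo s6 = t" "up s6 = up s" "best s6 = comm s4"
                using nframeD[OF fr(1)] rframeD[OF fr(2)] best by (simp_all add: s5 eq4)
              have "bracket s6"
                using br inp6 t sc full comm3 unfolding bracket_def eq4 eq6 by auto
              then show "?Q s6" using t by (simp add: eq6 t_def field_simps)
            qed simp_all
          qed (use bal_ge in simp)
        qed (use bal_le bal_ge in linarith)
      qed (use bal_le in linarith)
    qed (use bal_le bal_ge in linarith)
  qed ((use bal_le in linarith | simp)+)
qed (use bal_le bal_ge in linarith)

lemma run_setup_quota:
  assumes inp: "inp s"
  shows "run f setup_quota s (13 * bal) (\<lambda>s'. inp s' \<and> reals s' ''thr'' 0 = quota \<and> comm s' = {} \<and> nats s' ''cnt'' 0 = 0)"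
    (is "run f _ s _ ?Q")
  unfolding setup_quota_def
proof (rule run_Seq)
  show "run f (rset ''tot'' (rnum 0)) s 1 (\<lambda>s1. s1 = rupd ''tot'' 0 0 s)"
    by (intro run_RSet) auto
  fix s1 assume s1: "s1 = rupd ''tot'' 0 0 s"
  have inp1: "inp s1" by (rule inp_cong[OF inp]) (auto simp: s1)
  let ?p = "accum ''numvoters'' ''tot'' (NConst 0) (RGet ''strength'' J)"
  let ?t = "rset ''thr'' (RDiv (rvar ''tot'') (RNat (nvar ''seats'')))"
  let ?n = "nfill ''numcands'' ''cur'' (NConst 0)"
  let ?c = "nset ''cnt'' (NConst 0)"
  show "run f (Seq ?p (Seq ?t (Seq ?n ?c))) s1 (12 * bal) ?Q"
  proof (rule run_Seq)
    show "run f ?p s1 (5 * bal) (\<lambda>s'. \<forall>i. reals s' ''tot'' i =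
        reals s1 ''tot'' i + (\<Sum>j | j < nats s1 ''numvoters'' 0 \<and> (\<lambda>_. 0) j = i. strength I (vs ! j)))"
    proof (rule run_accum)
      fix j s' assume "j < nats s1 ''numvoters'' 0" "nats s' ''j'' 0 = j" "rframe ?p s1 s'"
      then show "nval (NConst 0) s' = 0 \<and> rval (RGet ''strength'' J) s' = strength I (vs ! j)"
        using inpD(1,6)[OF inp1] rframeD[of ?p s1 s' "''strength''"] by simp
    qed (use inpD(1)[OF inp1] vs_le bal_ge in auto)
    fix s2
    assume "\<forall>i. reals s2 ''tot'' i =
        reals s1 ''tot'' i + (\<Sum>j | j < nats s1 ''numvoters'' 0 \<and> (\<lambda>_. 0) j = i. strength I (vs ! j))"
      and fr: "nframe ?p s1 s2" "rframe ?p s1 s2"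
    then have "reals s2 ''tot'' 0 = (\<Sum>j | j < length vs. strength I (vs ! j))"
      using inpD(1)[OF inp1] by (simp add: s1)
    also have "\<dots> = sum (strength I) (voters I)"
      unfolding set_vs[symmetric] using distinct_vs
      by (intro sum.reindex_bij_betw bij_betw_nth) auto
    finally have tot: "reals s2 ''tot'' 0 = sum (strength I) (voters I)" .
    have inp2: "inp s2" by (rule inp_frame[OF inp1 fr]) auto
    show "run f (Seq ?t (Seq ?n ?c)) s2 (7 * bal) ?Q"
    proof (rule run_Seq)
      show "run f ?t s2 1 (\<lambda>s3. s3 = rupd ''thr'' 0 quota s2)"
        by (intro run_RSet) (auto simp: tot quota_def inpD(4)[OF inp2])
      fix s3 assume s3: "s3 = rupd ''thr'' 0 quota s2"
      have inp3: "inp s3" by (rule inp_cong[OF inp2]) (auto simp: s3)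
      show "run f (Seq ?n ?c) s3 (6 * bal) ?Q"
      proof (rule run_Seq)
        show "run f ?n s3 (5 * bal) (\<lambda>s'. \<forall>i<nats s3 ''numcands'' 0. nats s' ''cur'' i = 0)"
          using inpD(2)[OF inp3] cs_le bal_ge by (intro run_nfill) auto
        fix s4 assume z: "\<forall>i<nats s3 ''numcands'' 0. nats s4 ''cur'' i = 0"
          and fr: "nframe ?n s3 s4" "rframe ?n s3 s4"
        have inp4: "inp s4" by (rule inp_frame[OF inp3 fr]) auto
        have "inp (nupd ''cnt'' 0 0 s4)" by (rule inp_cong[OF inp4]) auto
        moreover have "reals s4 ''thr'' 0 = quota" using rframeD[OF fr(2)] by (simp add: s3)
        moreover have "comm s4 = {}" using z inpD(2)[OF inp3] by (auto simp: decode_cands_def)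
        ultimately show "run f ?c s4 bal ?Q" using bal_ge by (intro run_NSet) auto
      qed simp
    qed (use bal_ge in simp)
  qed simp
qed (use bal_ge in simp)

lemma run_seed:
  assumes inp: "inp s" and thr: "reals s ''thr'' 0 = quota" and empty: "comm s = {}" "nats s ''cnt'' 0 = 0"
  shows "run f seed s (33 * (bal * real (length cs))) (\<lambda>s'. inp s' \<and> reals s' ''thr'' 0 = quota \<and>
    quota_maximal (comm s') \<and> base s' = comm s' \<and> nats s' ''cnt'' 0 = card (comm s') \<and> nats s' ''bcnt'' 0 = card (comm s'))"
    (is "run f _ s _ ?Q")
  unfolding seed_def
proof (rule run_Seq[OF run_scan[OF inp]])
  show "hall I (comm s) (reals s ''thr'' 0)" unfolding empty hall_def nbrs_def by simp
  fix s1
  assume sc: "comm s \<subseteq> comm s1 \<and> nats s1 ''cnt'' 0 = card (comm s1) \<and> card (comm s1) \<le> seats I \<and>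
    hall I (comm s1) (reals s ''thr'' 0) \<and>
    (card (comm s1) = seats I \<or> (\<forall>c\<in>cands I - comm s1. \<not> hall I (insert c (comm s1)) (reals s ''thr'' 0)))"
    and fr: "nframe scan s s1" "rframe scan s s1"
  have inp1: "inp s1" by (rule inp_frame[OF inp fr]) auto
  have thr1: "reals s1 ''thr'' 0 = quota" using rframeD[OF fr(2)] thr by simp
  have max1: "quota_maximal (comm s1)" using sc comm_sub thr unfolding quota_maximal_def by simp
  let ?p = "nfill ''numcands'' ''base'' (NGet ''cur'' J)"
  show "run f (Seq ?p (nset ''bcnt'' (nvar ''cnt''))) s1 (6 * bal) ?Q"
  proof (rule run_Seq[OF run_copy[OF inp1]])
    fix s2 assume b: "base s2 = comm s1" and fr: "nframe ?p s1 s2" "rframe ?p s1 s2"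
    have inp2: "inp s2" by (rule inp_frame[OF inp1 fr]) auto
    have inp3: "inp (nupd ''bcnt'' 0 (nats s2 ''cnt'' 0) s2)" by (rule inp_cong[OF inp2]) auto
    have "nats s2 ''cur'' = nats s1 ''cur''" "nats s2 ''cnt'' = nats s1 ''cnt''" "reals s2 ''thr'' 0 = quota"
      using nframeD[OF fr(1)] rframeD[OF fr(2)] thr1 by simp_all
    then show "run f (nset ''bcnt'' (nvar ''cnt'')) s2 bal ?Q"
      using bal_ge inp3 b max1 sc by (intro run_NSet) auto
  qed simp_all
qed (use empty bal_le in \<open>simp | linarith\<close>)+

lemma run_start:
  assumes inp: "inp s" and thr: "reals s ''thr'' 0 = quota"
    and max: "quota_maximal (comm s)" and cnt: "nats s ''cnt'' 0 = card (comm s)"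
    and base: "base s = comm s" "nats s ''bcnt'' 0 = card (comm s)"
  shows "run f start s (84 * (bal * real (length cs))) (\<lambda>s'. bracket s' \<and> up s' \<le> 2 * lo s')"
    (is "run f _ s _ ?Q")
  unfolding start_def
proof (rule run_Seq[OF run_greedy[OF inp cnt]])
  show "card (comm s) \<le> seats I" using max by (simp add: quota_maximal_def)
  let ?up = "Cond (RLess (RMul (rnum 2) (rvar ''lo'')) (rvar ''thr''))
           (rset ''up'' (RMul (rnum 2) (rvar ''lo''))) (rset ''up'' (rvar ''thr''))"
  let ?cp = "nfill ''numcands'' ''committee'' (NGet ''cur'' J)"
  fix s1
  assume gr: "comm s \<subseteq> comm s1 \<and> card (comm s1) = seats I \<and>
    (\<forall>t B. 0 < t \<longrightarrow> B \<subseteq> cands I \<longrightarrow> card B = seats I \<longrightarrow> hall I B (4 * t) \<longrightarrow> hall I (comm s) t \<longrightarrow> hall I (comm s1) t)"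
    and fr: "nframe greedy s s1" "rframe greedy s s1"
  have inp1: "inp s1" by (rule inp_frame[OF inp fr]) auto
  have eq1: "nats s1 ''base'' = nats s ''base''" "nats s1 ''bcnt'' = nats s ''bcnt''" "reals s1 ''thr'' 0 = quota"
    using nframeD[OF fr(1)] rframeD[OF fr(2)] thr by simp_all
  have card1: "card (comm s1) \<le> seats I" using gr by simp
  show "run f (Seq evaluate (Seq (rset ''lo'' (rvar ''mn'')) (Seq ?up ?cp))) s1 (27 * bal) ?Q"
  proof (rule run_Seq[OF run_evaluate[OF inp1 card1]])
    fix s2
    assume ev: "reals s2 ''mn'' 0 \<le> reals s1 ''thr'' 0 \<and> hall I (comm s1) (reals s2 ''mn'' 0) \<and>
      (\<forall>t\<le>reals s1 ''thr'' 0. hall I (comm s1) t \<longrightarrow> t \<le> reals s2 ''mn'' 0)"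
      and fr: "nframe evaluate s1 s2" "rframe evaluate s1 s2"
    have inp2: "inp s2" by (rule inp_frame[OF inp1 fr]) auto
    have eq2: "nats s2 ''base'' = nats s ''base''" "nats s2 ''bcnt'' = nats s ''bcnt''" "reals s2 ''thr'' 0 = quota"
      "nats s2 ''cur'' = nats s1 ''cur''"
      using nframeD[OF fr(1)] rframeD[OF fr(2)] eq1 by simp_all
    define m where "m = reals s2 ''mn'' 0"
    have m: "m \<le> quota" "hall I (comm s1) m" "\<And>t. t \<le> quota \<Longrightarrow> hall I (comm s1) t \<Longrightarrow> t \<le> m"
      using ev by (auto simp: eq1 m_def)
    have m0: "0 \<le> m" using m(3)[of 0] quota_nonneg hall_zero by simp
    \<comment> \<open>The greedy guarantee is used at \<open>v / 4\<close>. This is at most the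
      quota, so the starting set attains it; if it exceeded \<open>m\<close>, the greedy committee
      would attain a threshold above the best one found by \<open>evaluate\<close>.\<close>
    have bound: "v \<le> 4 * m" "v \<le> quota" if B: "B \<subseteq> cands I" "card B = seats I" "hall I B v" for B v
    proof -
      show vq: "v \<le> quota" using hall_le_quota B by blast
      show "v \<le> 4 * m"
      proof (rule ccontr)
        assume "\<not> v \<le> 4 * m"
        then have less: "m < v / 4" by simp
        have q: "v / 4 \<le> quota" using less m0 vq by linarith
        have "hall I (comm s) quota" using max by (simp add: quota_maximal_def)
        then have "hall I (comm s) (v / 4)" using q hall_antimono by blast
        moreover have "hall I B (4 * (v / 4))" using B(3) by simp
        moreover have "0 < v / 4" using less m0 by linarith
        ultimately have "hall I (comm s1) (v / 4)" using gr B(1,2) by blast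
        then show False using m(3)[OF q] less by simp
      qed
    qed
    show "run f (Seq (rset ''lo'' (rvar ''mn'')) (Seq ?up ?cp)) s2 (8 * bal) ?Q"
    proof (rule run_Seq)
      show "run f (rset ''lo'' (rvar ''mn'')) s2 1 (\<lambda>s3. s3 = rupd ''lo'' 0 m s2)"
        by (intro run_RSet) (auto simp: m_def)
      fix s3 assume s3: "s3 = rupd ''lo'' 0 m s2"
      have inp3: "inp s3" by (rule inp_cong[OF inp2]) (auto simp: s3)
      show "run f (Seq ?up ?cp) s3 (7 * bal) ?Q"
      proof (rule run_Seq)
        show "run f ?up s3 2 (\<lambda>s4. s4 = rupd ''up'' 0 (min (2 * m) quota) s3)"
          by (rule run_Cond[where b = 1]; (rule run_RSet)?) (auto simp: s3 eq2 min_def)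
        fix s4 assume s4: "s4 = rupd ''up'' 0 (min (2 * m) quota) s3"
        have inp4: "inp s4" by (rule inp_cong[OF inp3]) (auto simp: s4)
        show "run f ?cp s4 (5 * bal) ?Q"
        proof (rule run_mono[OF run_copy[OF inp4]])
          fix s5 assume b: "best s5 = comm s4" and fr: "nframe ?cp s4 s5" "rframe ?cp s4 s5"
          have inp5: "inp s5" by (rule inp_frame[OF inp4 fr]) auto
          have eq5: "nats s5 ''base'' = nats s ''base''" "nats s5 ''bcnt'' = nats s ''bcnt''"
            "lo s5 = m" "up s5 = min (2 * m) quota" "best s5 = comm s1"
            using nframeD[OF fr(1)] rframeD[OF fr(2)] b by (simp_all add: s4 s3 eq2)
          have "\<forall>B v. B \<subseteq> cands I \<longrightarrow> card B = seats I \<longrightarrow> hall I B v \<longrightarrow> v \<le> 2 * min (2 * m) quota"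
          proof (intro allI impI)
            fix B v assume "B \<subseteq> cands I" "card B = seats I" "hall I B v"
            then show "v \<le> 2 * min (2 * m) quota" using bound[of B v] quota_nonneg by (simp add: min_def)
          qed
          then have "bracket s5"
            unfolding bracket_def eq5 using inp5 max base gr m m0 quota_nonneg by simp
          then show "?Q s5" by (simp add: eq5)
        qed simp_all
      qed (use bal_ge in simp)
    qed (use bal_ge in simp)
  qed simp
qed (use bal_le in linarith)

lemma run_search:
  assumes br: "bracket s" and up: "up s \<le> 2 * lo s" and n: "2 \<le> \<epsilon> * 2 ^ n"
  shows "run f (While unfinished bisect) s (1 + real n * (41 * (bal * real (length cs)) + 1))
    (\<lambda>s'. bracket s' \<and> 2 * up s' \<le> lo s' * (2 + \<epsilon>))"
proof -
  \<comment> \<open>The gap is measured against the fixed number \<open>lo s\<close>, while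
    \<open>lo s'\<close> only grows. With 0 iterations left it is at most \<epsilon> / 2 times
    \<open>lo s'\<close>, which is the negated loop test.\<close>
  let ?Inv = "\<lambda>n s'. bracket s' \<and> lo s \<le> lo s' \<and> up s' - lo s' \<le> \<epsilon> / 2 * lo s * 2 ^ n"
  have lo: "0 \<le> lo s" using br by (simp add: bracket_def)
  have done_iff: "bval unfinished s' \<longleftrightarrow> \<epsilon> * lo s' < 2 * (up s' - lo s')" if "bracket s'" for s'
    using that inpD(5)[of s'] unfolding bracket_def unfinished_def by (simp add: algebra_simps)
  have init: "?Inv n s"
  proof (intro conjI br order_refl)
    have "up s - lo s \<le> lo s" using up by simp
    also have "\<dots> \<le> \<epsilon> / 2 * lo s * 2 ^ n" using mult_right_mono[OF n lo] by (simp add: mult_ac)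
    finally show "up s - lo s \<le> \<epsilon> / 2 * lo s * 2 ^ n" .
  qed
  have nonneg: "0 \<le> 41 * (bal * real (length cs))" using bal_ge by simp
  have step: "0 < k \<and> run f bisect s' (41 * (bal * real (length cs))) (?Inv (k - 1))"
    if inv: "?Inv k s'" and un: "bval unfinished s'" for k s'
  proof -
    have un: "\<epsilon> * lo s' < 2 * (up s' - lo s')" using done_iff inv un by blast
    have "0 < k"
    proof (rule ccontr)
      assume "\<not> 0 < k"
      then have "2 * (up s' - lo s') \<le> \<epsilon> * lo s" using inv by simp
      moreover have "\<epsilon> * lo s \<le> \<epsilon> * lo s'" using inv eps by simp
      ultimately show False using un by simp
    qed
    then obtain j where k: "k = Suc j" by (cases k) auto
    have "run f bisect s' (41 * (bal * real (length cs))) (?Inv (k - 1))"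
      by (rule run_mono[OF run_bisect]) (use inv k in auto)
    then show ?thesis using \<open>0 < k\<close> by blast
  qed
  show ?thesis
  proof (rule run_mono[OF run_While[where Inv = ?Inv, OF step nonneg init]])
    fix s' assume "\<not> bval unfinished s' \<and> (\<exists>m. ?Inv m s')"
    then have "bracket s'" "\<not> bval unfinished s'" by auto
    then show "bracket s' \<and> 2 * up s' \<le> lo s' * (2 + \<epsilon>)"
      using done_iff by (simp add: algebra_simps)
  qed simp_all
qed

lemma run_lazy_mms:
  assumes inp: "inp s" and n: "2 \<le> \<epsilon> * 2 ^ n"
  shows "run f lazy_mms s ((132 + 42 * real n) * (bal * real (length cs))) (\<lambda>s'. \<exists>A w.
    output_store cs es A w s' \<and> approximation (2 + \<epsilon>) I A w \<and>
    (0 < (\<Sum>n\<in>voters I. strength I n) \<longrightarrow> PJR I A))" (is "run f _ s ?d ?Q")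
proof -
  let ?b = "bal * real (length cs)"
  let ?k = "1 + real n * (41 * ?b + 1)"
  have k: "?k \<le> 1 + real n * (42 * ?b)"
    using bal_le bal_ge by (intro add_left_mono mult_left_mono) linarith+
  show ?thesis
    unfolding lazy_mms_def
  \<comment> \<open>The budget is handed on after subtracting the finished phases, with costs 13, 33
    and 84. The 2 that remain of 132 pay for the last loop test and the final call.\<close>
  proof (rule run_Seq[OF run_setup_quota[OF inp], where c = "?d - 13 * ?b"])
    fix s1
    assume s1: "inp s1 \<and> reals s1 ''thr'' 0 = quota \<and> comm s1 = {} \<and> nats s1 ''cnt'' 0 = 0"
    show "run f (Seq seed (Seq start (Seq (While unfinished bisect) (Call ''committee'' ''weight'')))) s1 (?d - 13 * ?b) ?Q"
    proof (rule run_Seq[OF run_seed, where c = "?d - 46 * ?b"])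
      fix s2
      assume s2: "inp s2 \<and> reals s2 ''thr'' 0 = quota \<and> quota_maximal (comm s2) \<and> base s2 = comm s2 \<and>
        nats s2 ''cnt'' 0 = card (comm s2) \<and> nats s2 ''bcnt'' 0 = card (comm s2)"
      show "run f (Seq start (Seq (While unfinished bisect) (Call ''committee'' ''weight''))) s2 (?d - 46 * ?b) ?Q"
      proof (rule run_Seq[OF run_start, where c = "?d - 130 * ?b"])
        fix s3 assume s3: "bracket s3 \<and> up s3 \<le> 2 * lo s3"
        show "run f (Seq (While unfinished bisect) (Call ''committee'' ''weight'')) s3 (?d - 130 * ?b) ?Q"
        proof (rule run_Seq[OF run_search[OF _ _ n], where c = bal])
          fix s4 assume s4: "bracket s4 \<and> 2 * up s4 \<le> lo s4 * (2 + \<epsilon>)"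
          define A where "A = best s4"
          have A: "A \<subseteq> cands I" "card A = seats I" using s4 decode_sub[of cs] set_cs by (auto simp: A_def bracket_def)
          have ne: "A \<noteq> {}" "finite A" using A seats_pos finite_cands finite_subset by fastforce+
          have bal: "balanced I A (solve A)" using A by (intro solve_balanced) auto
          have full: "full_solution I A (solve A)"
            using A balanced_feasible[OF bal] by (simp add: full_solution_def)
          have "hall I A (lo s4)" using s4 by (simp add: A_def bracket_def)
          then have "lo s4 \<le> min_supp I (solve A) A"
            using balanced_supp_ge[OF bal A(1)] ne by (simp add: min_supp_def)
          moreover have "opt I \<le> lo s4 * (2 + \<epsilon>)"
          proof -
            have "opt I \<le> 2 * up s4" using s4 by (intro opt_le[OF full]) (auto simp: bracket_def)
            then show ?thesis using s4 by linarith
          qed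
          then have "opt I / (2 + \<epsilon>) \<le> lo s4" using eps by (simp add: pos_divide_le_eq)
          ultimately have approx: "approximation (2 + \<epsilon>) I A (solve A)"
            using full by (simp add: approximation_def)
          have pjr: "PJR I A" if "0 < (\<Sum>n\<in>voters I. strength I n)"
            using that s4 A unfolding bracket_def quota_maximal_def A_def
            by (intro PJR_if_quota_maximal[of "base s4"]) auto
          have "?Q (s4\<lparr>reals := (reals s4)(''weight'' := fst (f (nats s4 ''committee'')))\<rparr>)"
            using approx pjr
            by (intro exI[of _ A] exI[of _ "solve A"]) (auto simp: output_store_def A_def subroutine_def Let_def)
          moreover have "real (snd (f (nats s4 ''committee''))) \<le> bal"
            using time_le[of A] A by (simp add: subroutine_def Let_def A_def)
          ultimately show "run f (Call ''committee'' ''weight'') s4 bal ?Q"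
            by (rule run_Call)
        next
          show "?k + bal \<le> ?d - 130 * ?b" using k bal_le bal_ge by (simp only: distrib_right)
        qed (use s3 in \<open>simp | linarith\<close>)+
      qed (use s2 in \<open>simp | linarith\<close>)+
    qed (use s1 in \<open>simp | linarith\<close>)+
  qed (use bal_le in linarith)
qed

end

section \<open>The number of bisection steps\<close>

lemma bisection_steps:
  fixes \<epsilon> :: real
  assumes "0 < \<epsilon>"
  defines "L \<equiv> ln (1 / min \<epsilon> (1 / 2)) / ln 2"
  shows "\<exists>n. 2 \<le> \<epsilon> * 2 ^ n \<and> 132 + 42 * real n \<le> 258 * L"
proof -
  define e where "e = min \<epsilon> (1 / 2)"
  have e: "0 < e" "e \<le> 1 / 2" "e \<le> \<epsilon>" using assms by (auto simp: e_def)
  have L: "L = log 2 (1 / e)" by (simp add: L_def e_def log_def)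
  \<comment> \<open>Capping \<epsilon> at 1/2 serves this bound: additive constants can be absorbed
    into multiples of \<open>L\<close>, whereas the logarithm of 1/\<epsilon> itself vanishes at
    \<epsilon> = 1 and is negative beyond.\<close>
  have L1: "1 \<le> L" unfolding L using e by (subst le_log_iff) (auto simp: field_simps)
  \<comment> \<open>From n \<ge> L + 1 one gets 2^n \<ge> 2/e. From n \<le> L + 2 and L \<ge> 1 one
    gets 132 + 42 n \<le> 216 + 42 L \<le> 258 L.\<close>
  define n where "n = nat \<lceil>L + 1\<rceil>"
  have n: "L + 1 \<le> real n" "real n \<le> L + 2" using L1 by (auto simp: n_def) linarith+
  have "2 / e = 2 powr (L + 1)" using e by (simp add: L powr_add)
  also have "\<dots> \<le> 2 powr real n" using n by simp
  also have "\<dots> = 2 ^ n" by (simp add: powr_realpow)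
  finally have "2 \<le> e * 2 ^ n" using e by (simp add: field_simps)
  also have "\<dots> \<le> \<epsilon> * 2 ^ n" using e by simp
  finally show ?thesis using n L1 by (intro exI[of _ n]) auto
qed

theorem theorem5:
  "\<exists>(p :: prog) (K :: real).
     \<forall>(I :: (nat, nat) election) vs cs es (\<epsilon> :: real) solve time bal s.
       election_instance I \<longrightarrow>
       enumerates I vs cs es \<longrightarrow>
       0 < \<epsilon> \<longrightarrow>
       balancing_procedure I solve time bal \<longrightarrow>
       input_store I vs cs es \<epsilon> s \<longrightarrow>
       (\<exists>t s' A w.
          exec (subroutine cs es solve time) p s t s' \<and>
          output_store cs es A w s' \<and>
          approximation (2 + \<epsilon>) I A w \<and>
          (0 < (\<Sum>n\<in>voters I. strength I n) \<longrightarrow> PJR I A) \<and>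
          real t \<le> K * (bal * real (card (cands I)) * ln (1 / min \<epsilon> (1 / 2))))"
proof (rule exI[of _ lazy_mms], rule exI[of _ "258 / ln 2"], intro allI impI)
  fix I :: "(nat, nat) election" and vs cs es and \<epsilon> :: real and solve time bal s
  assume asm: "election_instance I" "enumerates I vs cs es" "0 < \<epsilon>" "balancing_procedure I solve time bal"
    and inp: "input_store I vs cs es \<epsilon> s"
  interpret machine I vs cs es \<epsilon> solve time bal
    using asm by unfold_locales
  obtain n where n: "2 \<le> \<epsilon> * 2 ^ n" "132 + 42 * real n \<le> 258 * (ln (1 / min \<epsilon> (1 / 2)) / ln 2)"
    using bisection_steps[OF eps] by blast
  have "(132 + 42 * real n) * (bal * real (length cs))
      \<le> 258 * (ln (1 / min \<epsilon> (1 / 2)) / ln 2) * (bal * real (length cs))"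
    using n(2) bal_ge by (intro mult_right_mono) auto
  also have "\<dots> = 258 / ln 2 * (bal * real (card (cands I)) * ln (1 / min \<epsilon> (1 / 2)))"
    by (simp add: length_cs)
  finally show "\<exists>t s' A w.
          exec (subroutine cs es solve time) lazy_mms s t s' \<and>
          output_store cs es A w s' \<and>
          approximation (2 + \<epsilon>) I A w \<and>
          (0 < (\<Sum>n\<in>voters I. strength I n) \<longrightarrow> PJR I A) \<and>
          real t \<le> 258 / ln 2 * (bal * real (card (cands I)) * ln (1 / min \<epsilon> (1 / 2)))"
    using run_lazy_mms[OF inp n(1)] unfolding run_def by (meson order_trans)
qed

end
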